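(* Let $N$ be a connected 2-step nilpotent Lie group with left-invariant pseudo-Riemannian metric tensor $\langle\,,\rangle$ and Lie algebra $\mathfrak n=\mathfrak U\oplus\mathfrak Z\oplus\mathfrak V\oplus\mathfrak E$. For all $u\in\mathfrak U$, $z,z'\in\mathfrak Z$, $v,v'\in\mathfrak V$, $e\in\mathfrak E$, and $x\in\mathfrak V\oplus\mathfrak E$, $$\operatorname{Ric}(u,\cdot)=0,$$ $$\operatorname{Ric}(z,z')=\tfrac14\sum_a\bar\varepsilon_a\langle j(\iota z)e_a,j(\iota z')e_a\rangle,$$ $$\operatorname{Ric}(v,z)=\tfrac14\sum_a\bar\varepsilon_a\langle j(\iota v)e_a,j(\iota z)e_a\rangle,$$ $$\operatorname{Ric}(e,z)=0,$$ $$\operatorname{Ric}(v,v')=-\tfrac12\sum_\alpha\varepsilon_\alpha\langle j(z_\alpha)v,j(z_\alpha)v'\rangle+\tfrac14\sum_a\bar\varepsilon_a\langle j(\iota v)e_a,j(\iota v')e_a\rangle,$$ $$\operatorname{Ric}(x,e)=-\tfrac12\sum_\alpha\varepsilon_\alpha\langle j(z_\alpha)x,j(z_\alpha)e\rangle.$$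
   Context: An inner product is a nondegenerate symmetric bilinear form. $\mathfrak n$ has center $\mathfrak z$, $[\mathfrak n,\mathfrak n]\subseteq\mathfrak z$. Decomposition: $\mathfrak U=\mathfrak z\cap\mathfrak z^\perp$; $\mathfrak V$ is a chosen totally null subspace with $\dim\mathfrak V=\dim\mathfrak U$, dually paired with $\mathfrak U$ by $\langle\,,\rangle$; $\mathfrak Z=\mathfrak z\cap\mathfrak U^\perp\cap\mathfrak V^\perp$; $\mathfrak E$ is the orthogonal complement of $\mathfrak Z$ in $\mathfrak U^\perp\cap\mathfrak V^\perp$. Then $\mathfrak z=\mathfrak U\oplus\mathfrak Z$. Choose a basis $\{u_i\}$ of $\mathfrak U$, the dual basis $\{v_i\}$ of $\mathfrak V$ ($\langle u_i,v_j\rangle=\delta_{ij}$), and orthonormal bases $\{z_\alpha\}$ of $\mathfrak Z$, $\{e_a\}$ of $\mathfrak E$ with $\langle z_\alpha,z_\alpha\rangle=\varepsilon_\alpha=\pm1$, $\langle e_a,e_a\rangle=\bar\varepsilon_a=\pm1$; the linear involution $\iota$ is $\iota u_i=v_i$, $\iota v_i=u_i$, $\iota z_\alpha=\varepsilon_\alpha z_\alpha$, $\iota e_a=\bar\varepsilon_ae_a$. The map $j:\mathfrak U\oplus\mathfrak Z\to\operatorname{End}(\mathfrak V\oplus\mathfrak E)$ is characterized by $\langle j(a)x,\iota y\rangle=\langle[x,y],\iota a\rangle$ for $x,y\in\mathfrak V\oplus\mathfrak E$. Conventions: $R(x,y)w=\nabla_x\nabla_yw-\nabla_y\nabla_xw-\nabla_{[x,y]}w$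 and $\operatorname{Ric}(x,y)=\operatorname{tr}(\xi\mapsto R(\xi,x)y)$. *)

theory Defs
  imports "HOL-Analysis.Analysis" "HOL-Library.Function_Algebras"
begin

section \<open>Linear algebra inside a real vector space\<close>

text \<open>Tangent vectors and vector fields below are elements of function spaces, so functions are
  made a real vector space with the pointwise operations; the library's \<open>subspace\<close>, \<open>span\<close>,
  \<open>dim\<close>, \<open>independent\<close> and \<open>representation\<close> then apply to sets of them.\<close>

instantiation "fun" :: (type, real_vector) real_vector
begin

definition "scaleR c f = (\<lambda>x. c *\<^sub>R f x)"

instance
  by standard (auto simp: scaleR_fun_def fun_eq_iff scaleR_add_right scaleR_add_left)

end

definition linear_map_on :: "'a::real_vector set \<Rightarrow> ('a \<Rightarrow> 'b::real_vector) \<Rightarrow> bool" where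
  "linear_map_on S f \<longleftrightarrow>
     (\<forall>x\<in>S. \<forall>y\<in>S. f (x + y) = f x + f y) \<and> (\<forall>c. \<forall>x\<in>S. f (c *\<^sub>R x) = c *\<^sub>R f x)"

definition is_basis :: "'a::real_vector set \<Rightarrow> 'i set \<Rightarrow> ('i \<Rightarrow> 'a) \<Rightarrow> bool" where
  "is_basis S I b \<longleftrightarrow> finite I \<and> inj_on b I \<and> independent (b ` I) \<and> span (b ` I) = S"

definition trace_on :: "'a::real_vector set \<Rightarrow> ('a \<Rightarrow> 'a) \<Rightarrow> real" where
  "trace_on S f =
     (let B = (SOME B. finite B \<and> independent B \<and> span B = S)
      in \<Sum>b\<in>B. representation B (f b) b)"

definition sum_space :: "'a::real_vector set \<Rightarrow> 'a set \<Rightarrow> 'a set" where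
  "sum_space S T = {s + t | s t. s \<in> S \<and> t \<in> T}"


section \<open>Smooth manifolds\<close>

text \<open>\<open>Ck_on k S f\<close>: \<open>f\<close> is of class \<open>C\<^sup>k\<close> on the open set \<open>S\<close>; only open \<open>S\<close> are used.\<close>

primrec Ck_on :: "nat \<Rightarrow> 'a::real_normed_vector set \<Rightarrow> ('a \<Rightarrow> 'b::real_normed_vector) \<Rightarrow> bool" where
  "Ck_on 0 S f \<longleftrightarrow> continuous_on S f"
| "Ck_on (Suc k) S f \<longleftrightarrow>
     (\<forall>x\<in>S. f differentiable (at x)) \<and> (\<forall>w. Ck_on k S (\<lambda>x. frechet_derivative f (at x) w))"

definition smooth_on :: "'a::real_normed_vector set \<Rightarrow> ('a \<Rightarrow> 'b::real_normed_vector) \<Rightarrow> bool" where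
  "smooth_on S f \<longleftrightarrow> (\<forall>k. Ck_on k S f)"

text \<open>A chart is a pair \<open>(U, \<phi>)\<close> of its domain and its coordinate map. The points of the
  manifold form the whole type \<open>'g\<close>, and \<open>'e\<close> is the model space.\<close>

type_synonym ('g, 'e) atlas = "('g set \<times> ('g \<Rightarrow> 'e)) set"

definition smooth_atlas :: "('g::{t2_space,second_countable_topology}, 'e::euclidean_space) atlas \<Rightarrow> bool" where
  "smooth_atlas A \<longleftrightarrow>
     (\<Union>(U, \<phi>)\<in>A. U) = UNIV \<and>
     (\<forall>(U, \<phi>)\<in>A. open U \<and> open (\<phi> ` U) \<and> homeomorphism U (\<phi> ` U) \<phi> (inv_into U \<phi>)) \<and>
     (\<forall>(U, \<phi>)\<in>A. \<forall>(W, \<psi>)\<in>A. smooth_on (\<phi> ` (U \<inter> W)) (\<psi> \<circ> inv_into U \<phi>))"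

definition smooth_functions :: "('g, 'e::euclidean_space) atlas \<Rightarrow> ('g \<Rightarrow> real) set" where
  "smooth_functions A = {f. \<forall>(U, \<phi>)\<in>A. smooth_on (\<phi> ` U) (f \<circ> inv_into U \<phi>)}"

text \<open>A tangent vector at \<open>p\<close> is a directional derivative at \<open>p\<close> in a chart, as an operator on
  smooth functions. It is set to \<open>0\<close> on functions that are not smooth, so that equal tangent
  vectors are equal as HOL functions.\<close>

type_synonym 'g tangent_vector = "('g \<Rightarrow> real) \<Rightarrow> real"

definition tangent_space :: "('g, 'e::euclidean_space) atlas \<Rightarrow> 'g \<Rightarrow> 'g tangent_vector set" where
  "tangent_space A p =
     {\<lambda>f. if f \<in> smooth_functions A
          then frechet_derivative (f \<circ> inv_into U \<phi>) (at (\<phi> p)) w else 0 | U \<phi> w.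
      (U, \<phi>) \<in> A \<and> p \<in> U}"

type_synonym 'g vector_field = "'g \<Rightarrow> 'g tangent_vector"

definition vector_fields :: "('g, 'e::euclidean_space) atlas \<Rightarrow> 'g vector_field set" where
  "vector_fields A =
     {X. (\<forall>p. X p \<in> tangent_space A p) \<and>
         (\<forall>f\<in>smooth_functions A. (\<lambda>p. X p f) \<in> smooth_functions A)}"

definition fun_smult :: "('g \<Rightarrow> real) \<Rightarrow> 'g vector_field \<Rightarrow> 'g vector_field" where
  "fun_smult f X = (\<lambda>p. f p *\<^sub>R X p)"

definition bracket :: "'g vector_field \<Rightarrow> 'g vector_field \<Rightarrow> 'g vector_field" where
  "bracket X Y = (\<lambda>p f. X p (\<lambda>q. Y q f) - Y p (\<lambda>q. X q f))"


section \<open>Pseudo-Riemannian geometry\<close>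

type_synonym 'g metric_tensor = "'g \<Rightarrow> 'g tangent_vector \<Rightarrow> 'g tangent_vector \<Rightarrow> real"

definition pseudo_riemannian_metric ::
  "('g, 'e::euclidean_space) atlas \<Rightarrow> 'g metric_tensor \<Rightarrow> bool" where
  "pseudo_riemannian_metric A g \<longleftrightarrow>
     (\<forall>p. (\<forall>v\<in>tangent_space A p. linear_map_on (tangent_space A p) (g p v)) \<and>
          (\<forall>v\<in>tangent_space A p. \<forall>w\<in>tangent_space A p. g p v w = g p w v) \<and>
          (\<forall>v\<in>tangent_space A p. (\<forall>w\<in>tangent_space A p. g p v w = 0) \<longrightarrow> v = 0)) \<and>
     (\<forall>X\<in>vector_fields A. \<forall>Y\<in>vector_fields A. (\<lambda>p. g p (X p) (Y p)) \<in> smooth_functions A)"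

definition affine_connection ::
  "('g, 'e::euclidean_space) atlas \<Rightarrow> ('g vector_field \<Rightarrow> 'g vector_field \<Rightarrow> 'g vector_field) \<Rightarrow> bool"
where
  "affine_connection A D \<longleftrightarrow>
     (\<forall>X\<in>vector_fields A. \<forall>Y\<in>vector_fields A. D X Y \<in> vector_fields A) \<and>
     (\<forall>X\<in>vector_fields A. \<forall>X'\<in>vector_fields A. \<forall>Y\<in>vector_fields A.
        D (X + X') Y = D X Y + D X' Y) \<and>
     (\<forall>f\<in>smooth_functions A. \<forall>X\<in>vector_fields A. \<forall>Y\<in>vector_fields A.
        D (fun_smult f X) Y = fun_smult f (D X Y)) \<and>
     (\<forall>X\<in>vector_fields A. linear_map_on (vector_fields A) (D X)) \<and>
     (\<forall>f\<in>smooth_functions A. \<forall>X\<in>vector_fields A. \<forall>Y\<in>vector_fields A.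
        D X (fun_smult f Y) = fun_smult (\<lambda>p. X p f) Y + fun_smult f (D X Y))"

definition levi_civita ::
  "('g, 'e::euclidean_space) atlas \<Rightarrow> 'g metric_tensor \<Rightarrow>
   ('g vector_field \<Rightarrow> 'g vector_field \<Rightarrow> 'g vector_field) \<Rightarrow> bool"
where
  "levi_civita A g D \<longleftrightarrow>
     affine_connection A D \<and>
     (\<forall>X\<in>vector_fields A. \<forall>Y\<in>vector_fields A. D X Y - D Y X = bracket X Y) \<and>
     (\<forall>X\<in>vector_fields A. \<forall>Y\<in>vector_fields A. \<forall>Z\<in>vector_fields A. \<forall>p.
        X p (\<lambda>q. g q (Y q) (Z q)) = g p (D X Y p) (Z p) + g p (Y p) (D X Z p))"

definition curvature ::
  "('g vector_field \<Rightarrow> 'g vector_field \<Rightarrow> 'g vector_field) \<Rightarrow>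
   'g vector_field \<Rightarrow> 'g vector_field \<Rightarrow> 'g vector_field \<Rightarrow> 'g vector_field"
where
  "curvature D X Y W = D X (D Y W) - D Y (D X W) - D (bracket X Y) W"


section \<open>Lie groups with a left-invariant metric\<close>

definition lie_group ::
  "('g::{t2_space,second_countable_topology}, 'e::euclidean_space) atlas \<Rightarrow>
   ('g \<Rightarrow> 'g \<Rightarrow> 'g) \<Rightarrow> 'g \<Rightarrow> ('g \<Rightarrow> 'g) \<Rightarrow> bool"
where
  "lie_group A mul e iv \<longleftrightarrow>
     smooth_atlas A \<and> Groups.group mul e iv \<and>
     continuous_on UNIV (\<lambda>(p, q). mul p q) \<and> continuous_on UNIV iv \<and>
     (\<forall>(U, \<phi>)\<in>A. \<forall>(V, \<theta>)\<in>A. \<forall>(W, \<psi>)\<in>A.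
        smooth_on {(x, y). x \<in> \<phi> ` U \<and> y \<in> \<theta> ` V \<and> mul (inv_into U \<phi> x) (inv_into V \<theta> y) \<in> W}
                  (\<lambda>(x, y). \<psi> (mul (inv_into U \<phi> x) (inv_into V \<theta> y)))) \<and>
     (\<forall>(U, \<phi>)\<in>A. \<forall>(W, \<psi>)\<in>A.
        smooth_on {x. x \<in> \<phi> ` U \<and> iv (inv_into U \<phi> x) \<in> W} (\<lambda>x. \<psi> (iv (inv_into U \<phi> x))))"

text \<open>The differential of left translation by \<open>h\<close>.\<close>

definition left_push :: "('g \<Rightarrow> 'g \<Rightarrow> 'g) \<Rightarrow> 'g \<Rightarrow> 'g tangent_vector \<Rightarrow> 'g tangent_vector" where
  "left_push mul h v = (\<lambda>f. v (\<lambda>q. f (mul h q)))"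

definition left_invariant_metric ::
  "('g, 'e::euclidean_space) atlas \<Rightarrow> ('g \<Rightarrow> 'g \<Rightarrow> 'g) \<Rightarrow> 'g metric_tensor \<Rightarrow> bool" where
  "left_invariant_metric A mul g \<longleftrightarrow>
     (\<forall>h p. \<forall>v\<in>tangent_space A p. \<forall>w\<in>tangent_space A p.
        g (mul h p) (left_push mul h v) (left_push mul h w) = g p v w)"

definition lie_algebra ::
  "('g, 'e::euclidean_space) atlas \<Rightarrow> ('g \<Rightarrow> 'g \<Rightarrow> 'g) \<Rightarrow> 'g vector_field set" where
  "lie_algebra A mul =
     {X \<in> vector_fields A. \<forall>h p. X (mul h p) = left_push mul h (X p)}"

text \<open>For left-invariant fields and a left-invariant metric \<open>g p (X p) (Y p)\<close> does not depend
  on \<open>p\<close>, so it may be taken at the identity \<open>e\<close>.\<close>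

definition inner_at ::
  "'g metric_tensor \<Rightarrow> 'g \<Rightarrow> 'g vector_field \<Rightarrow> 'g vector_field \<Rightarrow> real" where
  "inner_at g e X Y = g e (X e) (Y e)"

text \<open>The Ricci tensor on left-invariant fields: each tangent space is identified with the Lie
  algebra, over which the trace is taken.\<close>

definition ricci ::
  "('g, 'e::euclidean_space) atlas \<Rightarrow> ('g \<Rightarrow> 'g \<Rightarrow> 'g) \<Rightarrow>
   ('g vector_field \<Rightarrow> 'g vector_field \<Rightarrow> 'g vector_field) \<Rightarrow>
   'g vector_field \<Rightarrow> 'g vector_field \<Rightarrow> real"
where
  "ricci A mul D X Y = trace_on (lie_algebra A mul) (\<lambda>\<xi>. curvature D \<xi> X Y)"

definition lie_center :: "'g vector_field set \<Rightarrow> 'g vector_field set" where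
  "lie_center L = {X \<in> L. \<forall>Y\<in>L. bracket X Y = 0}"

definition perp :: "('a \<Rightarrow> 'a \<Rightarrow> real) \<Rightarrow> 'a set \<Rightarrow> 'a set \<Rightarrow> 'a set" where
  "perp ip L S = {x \<in> L. \<forall>y\<in>S. ip x y = 0}"

end

theory Submission
  imports Defs
begin

text \<open>
  By left invariance and the Koszul formula, the inner products of \<open>D X Y\<close> with left-invariant
  fields are constant for left-invariant \<open>X\<close>, \<open>Y\<close>; since every tangent vector extends to a
  left-invariant field, nondegeneracy of the metric makes \<open>D X Y\<close> left-invariant. The problem is
  then algebraic. If \<open>(b, d)\<close> runs through the pairs of mutually dual adapted basis vectors, then
  \<open>D b d = 0\<close>, and \<open>D u = 0\<close> for \<open>u\<close> in the null part of the center, so that the Koszul formula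
  and the vanishing of \<open>e\<^sub>a\<close> and \<open>u\<^sub>i\<close> against the center reduce the trace to
  \<open>Ric(x,y) = - 1/2 \<Sum>\<^sub>\<alpha>\<^sub>a \<epsilon>\<^sub>\<alpha> \<epsilon>'\<^sub>a \<langle>[x,e\<^sub>a],z\<^sub>\<alpha>\<rangle> \<langle>[y,e\<^sub>a],z\<^sub>\<alpha>\<rangle>
    + 1/4 \<Sum>\<^sub>a\<^sub>b \<epsilon>'\<^sub>a \<epsilon>'\<^sub>b \<langle>[e\<^sub>a,e\<^sub>b],x\<rangle> \<langle>[e\<^sub>a,e\<^sub>b],y\<rangle>\<close>.
  Expanding \<open>j(c)x\<close> in the \<open>e\<^sub>a\<close> turns the two sums into the stated ones.
\<close>

section \<open>Smooth functions on Euclidean spaces\<close>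

text \<open>A derivative at a point of an open set depends only on the values nearby, so agreement
  passes to all derivatives. Later closure proofs use this to replace the derivative of a compound
  function by its explicit formula.\<close>

lemma Ck_on_cong:
  assumes "open S" "\<And>x. x \<in> S \<Longrightarrow> f x = g x" "Ck_on k S f"
  shows "Ck_on k S g"
  using assms(2,3)
proof (induction k arbitrary: f g)
  case 0
  then show ?case
    by (simp cong: continuous_on_cong)
next
  case (Suc k)
  have g: "g differentiable (at x)"
      "frechet_derivative g (at x) = frechet_derivative f (at x)" if "x \<in> S" for x
  proof -
    have "(f has_derivative frechet_derivative f (at x)) (at x)"
      using Suc.prems(2) that by (simp add: frechet_derivative_works)
    then have *: "(g has_derivative frechet_derivative f (at x)) (at x)"
      using has_derivative_transform_within_open[OF _ \<open>open S\<close> that] Suc.prems(1) by blast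
    then show "g differentiable (at x)"
      by (auto simp: differentiable_def)
    show "frechet_derivative g (at x) = frechet_derivative f (at x)"
      using frechet_derivative_at[OF *] by simp
  qed
  have "Ck_on k S (\<lambda>x. frechet_derivative g (at x) w)" for w
    using Suc.IH[of "\<lambda>x. frechet_derivative f (at x) w"] Suc.prems(2) g(2) by simp
  then show ?case
    using g(1) by simp
qed

lemma Ck_on_local:
  assumes "\<And>x. x \<in> S \<Longrightarrow> \<exists>T. open T \<and> x \<in> T \<and> Ck_on k T f"
  shows "Ck_on k S f"
  using assms
proof (induction k arbitrary: f)
  case 0
  then show ?case
    by (fastforce intro!: continuous_at_imp_continuous_on simp: continuous_on_eq_continuous_at)
next
  case (Suc k)
  have "f differentiable (at x)" if "x \<in> S" for x
    using Suc.prems[OF that] by auto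
  moreover have "Ck_on k S (\<lambda>x. frechet_derivative f (at x) w)" for w
    using Suc.prems by (intro Suc.IH) fastforce
  ultimately show ?case by simp
qed

text \<open>The recursion of \<open>Ck_on\<close> peels derivatives off from the front, so the order
  drops only at the innermost level, where differentiability gives continuity; the induction carries
  this back through the derivatives.\<close>

lemma Ck_on_Suc_imp: "Ck_on (Suc k) S f \<Longrightarrow> Ck_on k S f"
proof (induction k arbitrary: f)
  case 0
  then show ?case
    by (auto intro: continuous_at_imp_continuous_on differentiable_imp_continuous_within)
next
  case (Suc k)
  have "Ck_on k S (\<lambda>x. frechet_derivative f (at x) w)" for w
    by (rule Suc.IH) (use Suc.prems in \<open>simp only: Ck_on.simps(2)[of "Suc k"]\<close>)
  then show ?case using Suc.prems by simp
qed

lemma Ck_on_const: "Ck_on k S (\<lambda>x. c)"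
  by (induction k arbitrary: c) (auto simp: frechet_derivative_const)

lemma Ck_on_add:
  assumes "Ck_on k S f" "Ck_on k S g" "open S"
  shows "Ck_on k S (\<lambda>x. f x + g x)"
  using assms(1,2)
proof (induction k arbitrary: f g)
  case 0
  then show ?case by (simp add: continuous_on_add)
next
  case (Suc k)
  have "Ck_on k S (\<lambda>x. frechet_derivative (\<lambda>x. f x + g x) (at x) w)" for w
  proof (rule Ck_on_cong[OF \<open>open S\<close>])
    show "Ck_on k S (\<lambda>x. frechet_derivative f (at x) w + frechet_derivative g (at x) w)"
      using Suc by simp
    show "frechet_derivative f (at x) w + frechet_derivative g (at x) w =
        frechet_derivative (\<lambda>x. f x + g x) (at x) w" if "x \<in> S" for x
    proof -
      have "((\<lambda>x. f x + g x) has_derivative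
          (\<lambda>w. frechet_derivative f (at x) w + frechet_derivative g (at x) w)) (at x)"
        using Suc.prems that
        by (intro has_derivative_add) (simp_all add: frechet_derivative_works[symmetric])
      then show ?thesis by (simp flip: frechet_derivative_at)
    qed
  qed
  then show ?case using Suc.prems by simp
qed

lemma Ck_on_sum:
  assumes "\<And>i. i \<in> I \<Longrightarrow> Ck_on k S (f i)" "open S"
  shows "Ck_on k S (\<lambda>x. \<Sum>i\<in>I. f i x)"
  using assms(1)
  by (induction I rule: infinite_finite_induct) (auto intro: Ck_on_add Ck_on_const \<open>open S\<close>)

text \<open>Product rule. Each summand of the derivative pairs one factor, lowered by one order with
  \<open>Ck_on_Suc_imp\<close>, with the derivative of the other; hence the induction is over both
  factors at once.\<close>

lemma Ck_on_scaleR: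
  assumes "Ck_on k S f" "Ck_on k S g" "open S"
  shows "Ck_on k S (\<lambda>x. f x *\<^sub>R g x)"
  using assms(1,2)
proof (induction k arbitrary: f g)
  case 0
  then show ?case by (simp add: continuous_on_scaleR)
next
  case (Suc k)
  have fg: "((\<lambda>x. f x *\<^sub>R g x) has_derivative
      (\<lambda>w. f x *\<^sub>R frechet_derivative g (at x) w + frechet_derivative f (at x) w *\<^sub>R g x)) (at x)"
    if "x \<in> S" for x
    using Suc.prems that
    by (intro has_derivative_scaleR) (simp_all add: frechet_derivative_works[symmetric])
  have "Ck_on k S (\<lambda>x. frechet_derivative (\<lambda>x. f x *\<^sub>R g x) (at x) w)" for w
  proof (rule Ck_on_cong[OF \<open>open S\<close>])
    show "Ck_on k S (\<lambda>x. f x *\<^sub>R frechet_derivative g (at x) w +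
        frechet_derivative f (at x) w *\<^sub>R g x)"
      using Suc Ck_on_Suc_imp[OF Suc.prems(1)] Ck_on_Suc_imp[OF Suc.prems(2)] \<open>open S\<close>
      by (intro Ck_on_add Suc.IH) simp_all
    show "f x *\<^sub>R frechet_derivative g (at x) w + frechet_derivative f (at x) w *\<^sub>R g x =
        frechet_derivative (\<lambda>x. f x *\<^sub>R g x) (at x) w" if "x \<in> S" for x
      by (simp flip: frechet_derivative_at[OF fg[OF that]])
  qed
  then show ?case using fg by (auto simp: differentiable_def)
qed

lemma Ck_on_bounded_linear:
  assumes "bounded_linear h" "Ck_on k S f" "open S"
  shows "Ck_on k S (\<lambda>x. h (f x))"
  using assms(2)
proof (induction k arbitrary: f)
  case 0
  then show ?case using assms(1) by (simp add: bounded_linear.continuous_on)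
next
  case (Suc k)
  have hf: "((\<lambda>x. h (f x)) has_derivative (\<lambda>w. h (frechet_derivative f (at x) w))) (at x)"
    if "x \<in> S" for x
    using Suc.prems that
    by (intro bounded_linear.has_derivative[OF assms(1)]) (simp add: frechet_derivative_works[symmetric])
  have "Ck_on k S (\<lambda>x. frechet_derivative (\<lambda>x. h (f x)) (at x) w)" for w
  proof (rule Ck_on_cong[OF \<open>open S\<close>])
    show "Ck_on k S (\<lambda>x. h (frechet_derivative f (at x) w))"
      using Suc by simp
    show "h (frechet_derivative f (at x) w) = frechet_derivative (\<lambda>x. h (f x)) (at x) w"
      if "x \<in> S" for x
      by (simp flip: frechet_derivative_at[OF hf[OF that]])
  qed
  then show ?case using hf by (auto simp: differentiable_def)
qed

text \<open>In the chain rule the direction in which \<open>f\<close> is differentiated varies with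
  the point, while \<open>Ck_on\<close> speaks of fixed directions only. Expanding the direction in
  \<open>Basis\<close> leaves products of coordinates of the derivative of \<open>g\<close> with
  fixed partial derivatives of \<open>f\<close> composed with \<open>g\<close>, to which the
  induction applies.\<close>

lemma Ck_on_compose:
  fixes f :: "'b::euclidean_space \<Rightarrow> 'c::real_normed_vector"
  assumes "Ck_on k T f" "Ck_on k S g" "open S" "g ` S \<subseteq> T"
  shows "Ck_on k S (\<lambda>x. f (g x))"
  using assms(1,2)
proof (induction k arbitrary: f)
  case 0
  then show ?case using assms(4) continuous_on_compose2 by auto
next
  case (Suc k)
  have fg: "((\<lambda>x. f (g x)) has_derivative
      (\<lambda>w. frechet_derivative f (at (g x)) (frechet_derivative g (at x) w))) (at x)"
    if "x \<in> S" for x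
    using Suc.prems that assms(4)
    by (intro has_derivative_compose[of g _ _ _ f])
       (auto simp: frechet_derivative_works[symmetric] image_subset_iff)
  have "Ck_on k S (\<lambda>x. frechet_derivative (\<lambda>x. f (g x)) (at x) w)" for w
  proof (rule Ck_on_cong[OF \<open>open S\<close>])
    show "Ck_on k S (\<lambda>x. \<Sum>b\<in>Basis. (frechet_derivative g (at x) w \<bullet> b) *\<^sub>R
        frechet_derivative f (at (g x)) b)"
      using Suc.prems Ck_on_Suc_imp[OF Suc.prems(2)] \<open>open S\<close>
      by (intro Ck_on_sum Ck_on_scaleR Suc.IH Ck_on_bounded_linear[OF bounded_linear_inner_left])
        simp_all
    show "(\<Sum>b\<in>Basis. (frechet_derivative g (at x) w \<bullet> b) *\<^sub>R frechet_derivative f (at (g x)) b) =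
        frechet_derivative (\<lambda>x. f (g x)) (at x) w" if "x \<in> S" for x
    proof -
      have "linear (frechet_derivative f (at (g x)))"
        using Suc.prems(1) that assms(4) by (intro linear_frechet_derivative) auto
      then have "frechet_derivative f (at (g x)) (\<Sum>b\<in>Basis. (frechet_derivative g (at x) w \<bullet> b) *\<^sub>R b)
        = (\<Sum>b\<in>Basis. (frechet_derivative g (at x) w \<bullet> b) *\<^sub>R frechet_derivative f (at (g x)) b)"
        by (simp add: linear_sum linear_scale)
      then show ?thesis
        by (simp add: euclidean_representation flip: frechet_derivative_at[OF fg[OF that]])
    qed
  qed
  then show ?case using fg by (auto simp: differentiable_def)
qed

lemma Ck_on_id: "Ck_on k S (\<lambda>x. x)"
  by (cases k) (simp_all add: Ck_on_const)

section \<open>Smooth functions\<close>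

lemma smooth_on_differentiable: "smooth_on S f \<Longrightarrow> x \<in> S \<Longrightarrow> f differentiable (at x)"
  unfolding smooth_on_def by (drule spec[of _ "Suc 0"]) simp

lemma smooth_on_derivative:
  assumes "smooth_on S f"
  shows "smooth_on S (\<lambda>x. frechet_derivative f (at x) w)"
  unfolding smooth_on_def
proof
  fix k
  have "Ck_on (Suc k) S f" using assms by (simp only: smooth_on_def)
  then show "Ck_on k S (\<lambda>x. frechet_derivative f (at x) w)" by simp
qed

lemma smooth_on_cong:
  "open S \<Longrightarrow> (\<And>x. x \<in> S \<Longrightarrow> f x = g x) \<Longrightarrow> smooth_on S f \<Longrightarrow> smooth_on S g"
  unfolding smooth_on_def by (auto intro: Ck_on_cong[of S f g])

lemma smooth_on_local:
  "(\<And>x. x \<in> S \<Longrightarrow> \<exists>T. open T \<and> x \<in> T \<and> smooth_on T f) \<Longrightarrow> smooth_on S f"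
  unfolding smooth_on_def by (intro allI Ck_on_local) blast

lemma smooth_on_const: "smooth_on S (\<lambda>x. c)"
  unfolding smooth_on_def by (simp add: Ck_on_const)

lemma smooth_on_add:
  "smooth_on S f \<Longrightarrow> smooth_on S g \<Longrightarrow> open S \<Longrightarrow> smooth_on S (\<lambda>x. f x + g x)"
  unfolding smooth_on_def by (simp add: Ck_on_add)

lemma smooth_on_bounded_linear:
  "bounded_linear h \<Longrightarrow> smooth_on S f \<Longrightarrow> open S \<Longrightarrow> smooth_on S (\<lambda>x. h (f x))"
  unfolding smooth_on_def by (simp add: Ck_on_bounded_linear)

lemma smooth_on_compose:
  fixes f :: "'b::euclidean_space \<Rightarrow> 'c::real_normed_vector"
  shows "smooth_on T f \<Longrightarrow> smooth_on S g \<Longrightarrow> open S \<Longrightarrow> g ` S \<subseteq> T \<Longrightarrow> smooth_on S (\<lambda>x. f (g x))"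
  unfolding smooth_on_def by (intro allI Ck_on_compose[of _ T f S g]) simp_all

lemma smooth_on_Pair_left:
  fixes y :: "'a::euclidean_space"
  shows "open S \<Longrightarrow> smooth_on S (\<lambda>x::'b::euclidean_space. (y, x))"
proof -
  assume S: "open S"
  have "smooth_on S (\<lambda>x::'b. (y, 0::'b) + (0, x))"
    using S by (intro smooth_on_add smooth_on_const smooth_on_bounded_linear[of "\<lambda>x. (0, x)"]
      bounded_linear_Pair bounded_linear_zero bounded_linear_ident)
      (simp_all add: smooth_on_def Ck_on_id)
  then show ?thesis by simp
qed

lemma smooth_on_Pair_right:
  fixes y :: "'a::euclidean_space"
  shows "open S \<Longrightarrow> smooth_on S (\<lambda>x::'b::euclidean_space. (x, y))"
proof -
  assume S: "open S"
  have "smooth_on S (\<lambda>x::'b. (0::'b, y) + (x, 0))"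
    using S by (intro smooth_on_add smooth_on_const smooth_on_bounded_linear[of "\<lambda>x. (x, 0)"]
      bounded_linear_Pair bounded_linear_zero bounded_linear_ident)
      (simp_all add: smooth_on_def Ck_on_id)
  then show ?thesis by simp
qed

section \<open>Tangent vectors and left-invariant fields\<close>

lemma chart_facts:
  assumes "smooth_atlas A" "(U, \<phi>) \<in> A"
  shows "open U" "open (\<phi> ` U)" "continuous_on U \<phi>" "continuous_on (\<phi> ` U) (inv_into U \<phi>)"
    "p \<in> U \<Longrightarrow> inv_into U \<phi> (\<phi> p) = p" "x \<in> \<phi> ` U \<Longrightarrow> \<phi> (inv_into U \<phi> x) = x"
    "x \<in> \<phi> ` U \<Longrightarrow> inv_into U \<phi> x \<in> U"
proof -
  have "open U \<and> open (\<phi> ` U) \<and> homeomorphism U (\<phi> ` U) \<phi> (inv_into U \<phi>)"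
    using assms by (auto simp: smooth_atlas_def)
  then show "open U" "open (\<phi> ` U)" "continuous_on U \<phi>" "continuous_on (\<phi> ` U) (inv_into U \<phi>)"
    "p \<in> U \<Longrightarrow> inv_into U \<phi> (\<phi> p) = p" "x \<in> \<phi> ` U \<Longrightarrow> \<phi> (inv_into U \<phi> x) = x"
    "x \<in> \<phi> ` U \<Longrightarrow> inv_into U \<phi> x \<in> U"
    by (auto simp: homeomorphism_def)
qed

lemma chart_exists:
  assumes "smooth_atlas A"
  obtains U \<phi> where "(U, \<phi>) \<in> A" "p \<in> U"
proof -
  have "p \<in> (\<Union>(U, \<phi>)\<in>A. U)"
    using assms by (simp add: smooth_atlas_def)
  then show thesis using that by blast
qed

lemma smooth_functions_chart:
  "f \<in> smooth_functions A \<Longrightarrow> (U, \<phi>) \<in> A \<Longrightarrow> smooth_on (\<phi> ` U) (\<lambda>x. f (inv_into U \<phi> x))"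
  by (auto simp: smooth_functions_def o_def)

lemma smooth_functionsI:
  "(\<And>U \<phi>. (U, \<phi>) \<in> A \<Longrightarrow> smooth_on (\<phi> ` U) (\<lambda>x. f (inv_into U \<phi> x))) \<Longrightarrow> f \<in> smooth_functions A"
  by (auto simp: smooth_functions_def o_def)

lemma smooth_functions_const: "(\<lambda>p. c) \<in> smooth_functions A"
  by (auto intro!: smooth_functionsI smooth_on_const)

lemma smooth_functions_add:
  "smooth_atlas A \<Longrightarrow> f \<in> smooth_functions A \<Longrightarrow> h \<in> smooth_functions A \<Longrightarrow>
    (\<lambda>p. f p + h p) \<in> smooth_functions A"
  by (rule smooth_functionsI, rule smooth_on_add)
    (auto intro: smooth_functions_chart chart_facts(2))

lemma smooth_functions_cmult:
  "smooth_atlas A \<Longrightarrow> f \<in> smooth_functions A \<Longrightarrow> (\<lambda>p. c * f p) \<in> smooth_functions A"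
  by (rule smooth_functionsI, rule smooth_on_bounded_linear[OF bounded_linear_mult_right])
    (auto intro: smooth_functions_chart chart_facts(2))

section \<open>Smooth self-maps and push-forward of tangent vectors\<close>

text \<open>Continuity is demanded separately because it makes the sets on which smoothness is
  tested open (\<open>open_chart_preimage\<close>).\<close>

definition smooth_map :: "('g::topological_space, 'e::euclidean_space) atlas \<Rightarrow> ('g \<Rightarrow> 'g) \<Rightarrow> bool" where
  "smooth_map A h \<longleftrightarrow> continuous_on UNIV h \<and>
     (\<forall>(U, \<phi>)\<in>A. \<forall>(W, \<psi>)\<in>A.
        smooth_on {x \<in> \<phi> ` U. h (inv_into U \<phi> x) \<in> W} (\<lambda>x. \<psi> (h (inv_into U \<phi> x))))"

lemma smooth_mapD:
  assumes "smooth_map A h"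
  shows "continuous_on UNIV h"
    "(U, \<phi>) \<in> A \<Longrightarrow> (W, \<psi>) \<in> A \<Longrightarrow>
      smooth_on {x \<in> \<phi> ` U. h (inv_into U \<phi> x) \<in> W} (\<lambda>x. \<psi> (h (inv_into U \<phi> x)))"
  using assms by (auto simp: smooth_map_def)

lemma open_chart_preimage:
  assumes "smooth_atlas A" "continuous_on UNIV h" "(U, \<phi>) \<in> A" "open W"
  shows "open {x \<in> \<phi> ` U. h (inv_into U \<phi> x) \<in> W}"
proof -
  have "continuous_on (\<phi> ` U) (\<lambda>x. h (inv_into U \<phi> x))"
    by (rule continuous_on_compose2[OF assms(2) chart_facts(4)[OF assms(1,3)]]) auto
  then have "open (\<phi> ` U \<inter> (\<lambda>x. h (inv_into U \<phi> x)) -` W)"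
    using chart_facts(2)[OF assms(1,3)] assms(4) by (rule continuous_open_preimage)
  moreover have "{x \<in> \<phi> ` U. h (inv_into U \<phi> x) \<in> W} = \<phi> ` U \<inter> (\<lambda>x. h (inv_into U \<phi> x)) -` W"
    by auto
  ultimately show ?thesis by simp
qed

text \<open>Smoothness of the identity is smoothness of the chart transitions; a change of chart can
  then be treated as a push-forward.\<close>

lemma smooth_map_id:
  assumes "smooth_atlas A"
  shows "smooth_map A (\<lambda>p. p)"
proof -
  have "smooth_on {x \<in> \<phi> ` U. inv_into U \<phi> x \<in> W} (\<lambda>x. \<psi> (inv_into U \<phi> x))"
    if "(U, \<phi>) \<in> A" "(W, \<psi>) \<in> A" for U \<phi> W \<psi>
  proof -
    have eq: "{x \<in> \<phi> ` U. inv_into U \<phi> x \<in> W} = \<phi> ` (U \<inter> W)"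
      using chart_facts(5)[OF assms that(1)] by auto
    have "\<forall>(U, \<phi>)\<in>A. \<forall>(W, \<psi>)\<in>A. smooth_on (\<phi> ` (U \<inter> W)) (\<lambda>x. \<psi> (inv_into U \<phi> x))"
      using assms by (simp add: smooth_atlas_def o_def)
    then show ?thesis unfolding eq
      using that by (blast dest: bspec[of A _ "(U, \<phi>)"])
  qed
  then show ?thesis by (auto simp: smooth_map_def)
qed

text \<open>Smoothness is local: near a given point the composite factors through one chart around
  its image under \<open>h\<close>, as a composition of two smooth Euclidean maps.\<close>

lemma smooth_functions_compose:
  assumes A: "smooth_atlas A" and h: "smooth_map A h" and f: "f \<in> smooth_functions A"
  shows "(\<lambda>q. f (h q)) \<in> smooth_functions A"
proof (intro smooth_functionsI smooth_on_local)
  fix U \<phi> x assume U: "(U, \<phi>) \<in> A" and x: "x \<in> \<phi> ` U"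
  obtain W \<psi> where W: "(W, \<psi>) \<in> A" "h (inv_into U \<phi> x) \<in> W"
    using chart_exists[OF A] by metis
  let ?T = "{x \<in> \<phi> ` U. h (inv_into U \<phi> x) \<in> W}"
  have T: "open ?T"
    by (rule open_chart_preimage[OF A smooth_mapD(1)[OF h] U chart_facts(1)[OF A W(1)]])
  have "smooth_on ?T (\<lambda>x. \<psi> (h (inv_into U \<phi> x)))"
    by (rule smooth_mapD(2)[OF h U W(1)])
  then have "smooth_on ?T (\<lambda>x. f (inv_into W \<psi> (\<psi> (h (inv_into U \<phi> x)))))"
    using smooth_on_compose[OF smooth_functions_chart[OF f W(1)] _ T] by auto
  then have "smooth_on ?T (\<lambda>x. f (h (inv_into U \<phi> x)))"
    by (rule smooth_on_cong[OF T, rotated]) (use chart_facts(5)[OF A W(1)] in auto)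
  then show "\<exists>T. open T \<and> x \<in> T \<and> smooth_on T (\<lambda>x. f (h (inv_into U \<phi> x)))"
    using T x W by blast
qed

definition chart_vector ::
  "('g, 'e::euclidean_space) atlas \<Rightarrow> 'g set \<Rightarrow> ('g \<Rightarrow> 'e) \<Rightarrow> 'g \<Rightarrow> 'e \<Rightarrow> 'g tangent_vector" where
  "chart_vector A U \<phi> p w = (\<lambda>f. if f \<in> smooth_functions A
     then frechet_derivative (\<lambda>x. f (inv_into U \<phi> x)) (at (\<phi> p)) w else 0)"

lemma tangent_space_eq_chart_vectors:
  "tangent_space A p = {chart_vector A U \<phi> p w | U \<phi> w. (U, \<phi>) \<in> A \<and> p \<in> U}"
  unfolding tangent_space_def chart_vector_def o_def ..

text \<open>The right inverse \<open>k\<close> is needed because tangent vectors vanish on non-smooth functions: without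
  it \<open>f \<circ> h\<close> could be smooth for a non-smooth \<open>f\<close>.\<close>

lemma chart_vector_push:
  assumes A: "smooth_atlas A" and h: "smooth_map A h" and k: "smooth_map A k" and hk: "\<And>q. h (k q) = q"
    and U: "(U, \<phi>) \<in> A" "p \<in> U" and W: "(W, \<psi>) \<in> A" "h p \<in> W"
  shows "(\<lambda>f. chart_vector A U \<phi> p w (\<lambda>q. f (h q))) =
    chart_vector A W \<psi> (h p) (frechet_derivative (\<lambda>x. \<psi> (h (inv_into U \<phi> x))) (at (\<phi> p)) w)"
proof
  fix f
  show "chart_vector A U \<phi> p w (\<lambda>q. f (h q)) =
    chart_vector A W \<psi> (h p) (frechet_derivative (\<lambda>x. \<psi> (h (inv_into U \<phi> x))) (at (\<phi> p)) w) f"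
  proof (cases "f \<in> smooth_functions A")
    case f: True
    let ?T = "{x \<in> \<phi> ` U. h (inv_into U \<phi> x) \<in> W}"
    let ?c = "\<lambda>x. \<psi> (h (inv_into U \<phi> x))" and ?d = "\<lambda>y. f (inv_into W \<psi> y)"
    have T: "open ?T"
      by (rule open_chart_preimage[OF A smooth_mapD(1)[OF h] U(1) chart_facts(1)[OF A W(1)]])
    have pT: "\<phi> p \<in> ?T"
      using U W chart_facts(5)[OF A U(1)] by auto
    have "smooth_on ?T ?c"
      by (rule smooth_mapD(2)[OF h U(1) W(1)])
    then have c: "?c differentiable (at (\<phi> p))"
      using pT by (rule smooth_on_differentiable)
    have cp: "?c (\<phi> p) = \<psi> (h p)"
      using chart_facts(5)[OF A U(1)] U by simp
    have d: "?d differentiable (at (\<psi> (h p)))"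
      using smooth_on_differentiable[OF smooth_functions_chart[OF f W(1)]] W by simp
    have "((\<lambda>x. ?d (?c x)) has_derivative (\<lambda>w. frechet_derivative ?d (at (\<psi> (h p)))
        (frechet_derivative ?c (at (\<phi> p)) w))) (at (\<phi> p))"
      using c d cp by (intro has_derivative_compose[of ?c _ _ _ ?d])
        (simp_all add: frechet_derivative_works[symmetric])
    then have "((\<lambda>x. f (h (inv_into U \<phi> x))) has_derivative
        (\<lambda>w. frechet_derivative ?d (at (\<psi> (h p))) (frechet_derivative ?c (at (\<phi> p)) w))) (at (\<phi> p))"
      by (rule has_derivative_transform_within_open[OF _ T pT])
        (use chart_facts(5)[OF A W(1)] in auto)
    then have "frechet_derivative (\<lambda>x. f (h (inv_into U \<phi> x))) (at (\<phi> p)) =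
        (\<lambda>w. frechet_derivative ?d (at (\<psi> (h p))) (frechet_derivative ?c (at (\<phi> p)) w))"
      by (rule frechet_derivative_at[symmetric])
    then show ?thesis
      using f smooth_functions_compose[OF A h f] by (simp add: chart_vector_def)
  next
    case False
    have "(\<lambda>q. f (h q)) \<notin> smooth_functions A"
    proof
      assume "(\<lambda>q. f (h q)) \<in> smooth_functions A"
      from smooth_functions_compose[OF A k this] have "f \<in> smooth_functions A"
        by (simp only: hk)
      with False show False ..
    qed
    with False show ?thesis by (simp add: chart_vector_def)
  qed
qed

lemma tangent_space_push:
  assumes "smooth_atlas A" "smooth_map A h" "smooth_map A k" "\<And>q. h (k q) = q" "v \<in> tangent_space A p"
  shows "(\<lambda>f. v (\<lambda>q. f (h q))) \<in> tangent_space A (h p)"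
proof -
  obtain U \<phi> w where U: "(U, \<phi>) \<in> A" "p \<in> U" and v: "v = chart_vector A U \<phi> p w"
    using assms(5) by (auto simp: tangent_space_eq_chart_vectors)
  obtain W \<psi> where W: "(W, \<psi>) \<in> A" "h p \<in> W"
    using chart_exists[OF assms(1)] by metis
  show ?thesis
    unfolding v chart_vector_push[OF assms(1-4) U W] tangent_space_eq_chart_vectors using W by blast
qed

section \<open>Linear structure of tangent spaces and of spaces of fields\<close>

text \<open>Pushing forward by the identity rewrites a vector given in any chart in the chosen one.
  A single chart thus exhibits the tangent space as a linear image of the model space, which makes
  it a subspace.\<close>

lemma tangent_space_chart:
  assumes A: "smooth_atlas A" and W: "(W, \<psi>) \<in> A" "p \<in> W"
  shows "tangent_space A p = range (chart_vector A W \<psi> p)"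
proof -
  have "chart_vector A U \<phi> p w \<in> range (chart_vector A W \<psi> p)" if "(U, \<phi>) \<in> A" "p \<in> U" for U \<phi> w
    using chart_vector_push[OF A smooth_map_id[OF A] smooth_map_id[OF A] refl that W, of w] by auto
  then show ?thesis using W by (auto simp: tangent_space_eq_chart_vectors)
qed

lemma linear_chart_vector:
  assumes A: "smooth_atlas A" and W: "(W, \<psi>) \<in> A" "p \<in> W"
  shows "linear (chart_vector A W \<psi> p)"
proof -
  have "linear (frechet_derivative (\<lambda>x. f (inv_into W \<psi> x)) (at (\<psi> p)))"
    if "f \<in> smooth_functions A" for f
    using that W smooth_on_differentiable[OF smooth_functions_chart[OF that W(1)]]
    by (intro linear_frechet_derivative) simp
  then show ?thesis
    by (intro linearI)
      (auto simp: chart_vector_def fun_eq_iff scaleR_fun_def linear_add linear_scale)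
qed

lemma subspace_tangent_space:
  assumes A: "smooth_atlas A"
  shows "subspace (tangent_space A p)"
proof -
  obtain W \<psi> where W: "(W, \<psi>) \<in> A" "p \<in> W"
    using chart_exists[OF A] by metis
  show ?thesis
    unfolding tangent_space_chart[OF A W]
    by (intro linear_subspace_image linear_chart_vector A W subspace_UNIV)
qed

lemma tangent_vector_const:
  assumes "v \<in> tangent_space A p"
  shows "v (\<lambda>q. c) = 0"
  using assms by (auto simp: tangent_space_def o_def)

lemma subspace_vector_fields:
  assumes A: "smooth_atlas A"
  shows "subspace (vector_fields A)"
  using subspace_tangent_space[OF A] smooth_functions_add[OF A] smooth_functions_cmult[OF A]
    smooth_functions_const[of 0 A]
  by (auto simp: vector_fields_def subspace_def scaleR_fun_def)

lemma subspace_lie_algebra: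
  assumes A: "smooth_atlas A"
  shows "subspace (lie_algebra A mul)"
  using subspace_vector_fields[OF A]
  by (auto simp: lie_algebra_def subspace_def left_push_def scaleR_fun_def)

section \<open>Left translations and left-invariant extensions\<close>

lemma lie_groupD:
  assumes "lie_group A mul one iv"
  shows "smooth_atlas A" "Groups.group mul one iv" "continuous_on UNIV (\<lambda>(p, q). mul p q)"
  using assms by (auto simp: lie_group_def)

lemma lie_group_simps:
  assumes "lie_group A mul one iv"
  shows "mul one p = p" "mul p one = p" "mul (iv p) p = one" "mul p (iv p) = one"
    "mul (mul p q) r = mul p (mul q r)" "mul (iv p) (mul p q) = q" "mul p (mul (iv p) q) = q"
proof -
  interpret Groups.group mul one iv using lie_groupD(2)[OF assms] .
  show "mul one p = p" "mul p one = p" "mul (iv p) p = one" "mul p (iv p) = one"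
    "mul (mul p q) r = mul p (mul q r)" by (simp_all add: assoc)
  show "mul (iv p) (mul p q) = q" "mul p (mul (iv p) q) = q"
    by (simp_all flip: assoc)
qed

lemma open_mul_preimage:
  assumes G: "lie_group A mul one iv"
    and U: "(U, \<phi>) \<in> A" and V: "(V, \<theta>) \<in> A" and W: "(W, \<psi>) \<in> A"
  shows "open {(x, y). x \<in> \<phi> ` U \<and> y \<in> \<theta> ` V \<and> mul (inv_into U \<phi> x) (inv_into V \<theta> y) \<in> W}"
    (is "open ?S")
proof -
  note A = lie_groupD(1)[OF G]
  have "continuous_on (\<phi> ` U \<times> \<theta> ` V) (\<lambda>z. (inv_into U \<phi> (fst z), inv_into V \<theta> (snd z)))"
    by (intro continuous_on_Pair continuous_on_compose2[OF chart_facts(4)[OF A U]]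
        continuous_on_compose2[OF chart_facts(4)[OF A V]] continuous_on_fst continuous_on_snd
        continuous_on_id) auto
  from continuous_on_compose2[OF lie_groupD(3)[OF G] this]
  have "continuous_on (\<phi> ` U \<times> \<theta> ` V) (\<lambda>z. mul (inv_into U \<phi> (fst z)) (inv_into V \<theta> (snd z)))"
    by simp
  then have "open ((\<phi> ` U \<times> \<theta> ` V) \<inter> (\<lambda>z. mul (inv_into U \<phi> (fst z)) (inv_into V \<theta> (snd z))) -` W)"
    by (rule continuous_open_preimage)
      (intro open_Times chart_facts(1)[OF A W] chart_facts(2)[OF A U] chart_facts(2)[OF A V])+
  moreover have "?S = (\<phi> ` U \<times> \<theta> ` V) \<inter>
      (\<lambda>z. mul (inv_into U \<phi> (fst z)) (inv_into V \<theta> (snd z))) -` W"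
    by auto
  ultimately show ?thesis by simp
qed

lemma smooth_on_mul:
  assumes G: "lie_group A mul one iv"
    and U: "(U, \<phi>) \<in> A" and V: "(V, \<theta>) \<in> A" and W: "(W, \<psi>) \<in> A"
  shows "smooth_on {(x, y). x \<in> \<phi> ` U \<and> y \<in> \<theta> ` V \<and> mul (inv_into U \<phi> x) (inv_into V \<theta> y) \<in> W}
    (\<lambda>(x, y). \<psi> (mul (inv_into U \<phi> x) (inv_into V \<theta> y)))"
proof -
  have "\<forall>(U, \<phi>)\<in>A. \<forall>(V, \<theta>)\<in>A. \<forall>(W, \<psi>)\<in>A.
        smooth_on {(x, y). x \<in> \<phi> ` U \<and> y \<in> \<theta> ` V \<and> mul (inv_into U \<phi> x) (inv_into V \<theta> y) \<in> W}
                  (\<lambda>(x, y). \<psi> (mul (inv_into U \<phi> x) (inv_into V \<theta> y)))"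
    using G by (simp add: lie_group_def)
  from bspec[OF bspec[OF bspec[OF this U, simplified] V, simplified] W, simplified]
  show ?thesis .
qed

lemma smooth_on_function_mul:
  assumes G: "lie_group A mul one iv" and f: "f \<in> smooth_functions A"
    and U: "(U, \<phi>) \<in> A" and V: "(V, \<theta>) \<in> A"
  shows "smooth_on (\<phi> ` U \<times> \<theta> ` V) (\<lambda>z. f (mul (inv_into U \<phi> (fst z)) (inv_into V \<theta> (snd z))))"
proof (rule smooth_on_local)
  note A = lie_groupD(1)[OF G]
  fix z assume z: "z \<in> \<phi> ` U \<times> \<theta> ` V"
  let ?m = "\<lambda>z. mul (inv_into U \<phi> (fst z)) (inv_into V \<theta> (snd z))"
  obtain W \<psi> where W: "(W, \<psi>) \<in> A" "?m z \<in> W"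
    using chart_exists[OF A] by metis
  let ?T = "{(x, y). x \<in> \<phi> ` U \<and> y \<in> \<theta> ` V \<and> mul (inv_into U \<phi> x) (inv_into V \<theta> y) \<in> W}"
  have T: "open ?T"
    by (rule open_mul_preimage[OF G U V W(1)])
  have "smooth_on ?T (\<lambda>z. f (inv_into W \<psi> ((\<lambda>(x, y). \<psi> (mul (inv_into U \<phi> x) (inv_into V \<theta> y))) z)))"
    by (rule smooth_on_compose[OF smooth_functions_chart[OF f W(1)] smooth_on_mul[OF G U V W(1)] T])
      auto
  then have "smooth_on ?T (\<lambda>z. f (?m z))"
    by (rule smooth_on_cong[OF T, rotated]) (use chart_facts(5)[OF A W(1)] in auto)
  then show "\<exists>T. open T \<and> z \<in> T \<and> smooth_on T (\<lambda>z. f (?m z))"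
    using T z W by (intro exI[of _ ?T]) auto
qed

lemma smooth_map_mul:
  assumes G: "lie_group A mul one iv"
  shows "smooth_map A (mul h)"
proof -
  note A = lie_groupD(1)[OF G]
  obtain V \<theta> where V: "(V, \<theta>) \<in> A" "h \<in> V"
    using chart_exists[OF A] by metis
  have c: "continuous_on UNIV (mul h)"
    using continuous_on_compose2[OF lie_groupD(3)[OF G], of UNIV "\<lambda>q. (h, q)"]
    by (simp add: continuous_on_Pair continuous_on_const continuous_on_id)
  have "smooth_on {x \<in> \<phi> ` U. mul h (inv_into U \<phi> x) \<in> W} (\<lambda>x. \<psi> (mul h (inv_into U \<phi> x)))"
      (is "smooth_on ?S _")
    if U: "(U, \<phi>) \<in> A" and W: "(W, \<psi>) \<in> A" for U \<phi> W \<psi>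
  proof -
    have S: "open ?S"
      by (rule open_chart_preimage[OF A c U chart_facts(1)[OF A W]])
    \<comment> \<open>Left translation is the multiplication restricted to the slice where the first
      coordinate is that of \<open>h\<close>.\<close>
    have "smooth_on ?S (\<lambda>x. (\<lambda>(x, y). \<psi> (mul (inv_into V \<theta> x) (inv_into U \<phi> y))) (\<theta> h, x))"
      by (rule smooth_on_compose[OF smooth_on_mul[OF G V(1) U W] smooth_on_Pair_left[OF S] S])
        (use V chart_facts(5)[OF A V(1)] in auto)
    then show ?thesis using V chart_facts(5)[OF A V(1)] by simp
  qed
  then show ?thesis using c by (auto simp: smooth_map_def)
qed

text \<open>Translation by \<open>iv h\<close> is the smooth right inverse that
  \<open>tangent_space_push\<close> asks for.\<close>

lemma left_push_tangent_space:
  assumes G: "lie_group A mul one iv" and v: "v \<in> tangent_space A p"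
  shows "left_push mul h v \<in> tangent_space A (mul h p)"
  unfolding left_push_def
  by (rule tangent_space_push[OF lie_groupD(1)[OF G] smooth_map_mul[OF G] smooth_map_mul[OF G, of "iv h"] _ v])
    (simp add: lie_group_simps[OF G])

text \<open>This is the smoothness of the left-invariant field generated by \<open>v\<close>. In
  charts its value is a partial derivative, in the second factor at \<open>one\<close>, of the
  jointly smooth function \<open>f (mul p q)\<close>. Read as a full derivative in the fixed
  direction \<open>(0, w)\<close>, it is smooth in \<open>p\<close>.\<close>

lemma smooth_function_left_translates_derivative:
  assumes G: "lie_group A mul one iv" and v: "v \<in> tangent_space A one" and f: "f \<in> smooth_functions A"
  shows "(\<lambda>p. v (\<lambda>q. f (mul p q))) \<in> smooth_functions A"
proof (rule smooth_functionsI)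
  note A = lie_groupD(1)[OF G]
  fix V \<theta> assume V: "(V, \<theta>) \<in> A"
  obtain U \<phi> w where U: "(U, \<phi>) \<in> A" "one \<in> U" and vw: "v = chart_vector A U \<phi> one w"
    using v by (auto simp: tangent_space_eq_chart_vectors)
  let ?F = "\<lambda>z. f (mul (inv_into V \<theta> (fst z)) (inv_into U \<phi> (snd z)))"
  have F: "smooth_on (\<theta> ` V \<times> \<phi> ` U) ?F"
    by (rule smooth_on_function_mul[OF G f V U(1)])
  have V': "open (\<theta> ` V)" using chart_facts(2)[OF A V] .
  have "smooth_on (\<theta> ` V) (\<lambda>y. frechet_derivative ?F (at (y, \<phi> one)) (0, w))"
    by (rule smooth_on_compose[OF smooth_on_derivative[OF F] smooth_on_Pair_right[OF V'] V'])
      (use U in auto)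
  then show "smooth_on (\<theta> ` V) (\<lambda>y. v (\<lambda>q. f (mul (inv_into V \<theta> y) q)))"
  proof (rule smooth_on_cong[OF V', rotated])
    fix y assume y: "y \<in> \<theta> ` V"
    have "?F differentiable (at (y, \<phi> one))"
      using F y U by (intro smooth_on_differentiable) auto
    then have "(?F has_derivative frechet_derivative ?F (at (y, \<phi> one))) (at (y, \<phi> one))"
      by (simp add: frechet_derivative_works)
    \<comment> \<open>The chain rule along the slice \<open>(y, x)\<close> identifies the partial
      derivative with the full one in direction \<open>(0, w)\<close>.\<close>
    then have "((\<lambda>x. ?F (y, x)) has_derivative (\<lambda>w. frechet_derivative ?F (at (y, \<phi> one)) (0, w)))
        (at (\<phi> one))"
      by (intro has_derivative_compose[of "\<lambda>x. (y, x)" "\<lambda>w. (0, w)" _ _ ?F] has_derivative_Pair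
          has_derivative_const has_derivative_ident)
    from frechet_derivative_at[OF this]
    show "frechet_derivative ?F (at (y, \<phi> one)) (0, w) = v (\<lambda>q. f (mul (inv_into V \<theta> y) q))"
      using smooth_functions_compose[OF A smooth_map_mul[OF G] f]
      by (simp add: vw chart_vector_def fun_eq_iff)
  qed
qed

text \<open>The vector is carried back to the identity by \<open>iv p\<close> and spread over the
  group by left translations. Pairings with left-invariant fields therefore suffice to determine a
  tangent vector.\<close>

lemma left_invariant_extension:
  assumes G: "lie_group A mul one iv" and t: "t \<in> tangent_space A p"
  obtains X where "X \<in> lie_algebra A mul" "X p = t"
proof
  note A = lie_groupD(1)[OF G]
  define v where "v = left_push mul (iv p) t"
  have v: "v \<in> tangent_space A one"
    using left_push_tangent_space[OF G t, of "iv p"] by (simp add: v_def lie_group_simps[OF G])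
  define X where "X = (\<lambda>p. left_push mul p v)"
  have "X q \<in> tangent_space A q" for q
    using left_push_tangent_space[OF G v, of q] by (simp add: X_def lie_group_simps[OF G])
  moreover have "(\<lambda>q. X q f) \<in> smooth_functions A" if "f \<in> smooth_functions A" for f
    using smooth_function_left_translates_derivative[OF G v that] by (simp add: X_def left_push_def)
  ultimately show "X \<in> lie_algebra A mul"
    by (auto simp: lie_algebra_def vector_fields_def X_def left_push_def lie_group_simps[OF G])
  show "X p = t"
    by (simp add: X_def v_def left_push_def lie_group_simps[OF G])
qed

section \<open>The Levi-Civita connection on left-invariant fields\<close>

locale left_invariant_levi_civita =
  fixes A :: "('g::{t2_space,second_countable_topology}, 'e::euclidean_space) atlas"
    and mul :: "'g \<Rightarrow> 'g \<Rightarrow> 'g" and one :: 'g and iv :: "'g \<Rightarrow> 'g"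
    and g :: "'g metric_tensor"
    and D :: "'g vector_field \<Rightarrow> 'g vector_field \<Rightarrow> 'g vector_field"
  assumes group: "lie_group A mul one iv"
    and metric: "pseudo_riemannian_metric A g"
    and invariant: "left_invariant_metric A mul g"
    and connection: "levi_civita A g D"
begin

abbreviation "\<nn> \<equiv> lie_algebra A mul"
abbreviation "ip \<equiv> inner_at g one"

section \<open>The metric and the connection on left-invariant fields\<close>

lemma atlas: "smooth_atlas A"
  using group by (rule lie_groupD)

lemma lie_algebra_field: "X \<in> \<nn> \<Longrightarrow> X \<in> vector_fields A"
  by (simp add: lie_algebra_def)

lemma field_tangent: "X \<in> vector_fields A \<Longrightarrow> X p \<in> tangent_space A p"
  by (simp add: vector_fields_def)

lemma metric_add:
  "v \<in> tangent_space A p \<Longrightarrow> w \<in> tangent_space A p \<Longrightarrow> w' \<in> tangent_space A p \<Longrightarrow>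
    g p v (w + w') = g p v w + g p v w'"
  using metric by (simp add: pseudo_riemannian_metric_def linear_map_on_def)

lemma metric_scaleR:
  "v \<in> tangent_space A p \<Longrightarrow> w \<in> tangent_space A p \<Longrightarrow> g p v (c *\<^sub>R w) = c * g p v w"
  using metric by (simp add: pseudo_riemannian_metric_def linear_map_on_def)

lemma metric_sym:
  "v \<in> tangent_space A p \<Longrightarrow> w \<in> tangent_space A p \<Longrightarrow> g p v w = g p w v"
  using metric by (simp add: pseudo_riemannian_metric_def)

lemma metric_nondegenerate:
  "v \<in> tangent_space A p \<Longrightarrow> (\<And>w. w \<in> tangent_space A p \<Longrightarrow> g p v w = 0) \<Longrightarrow> v = 0"
  using metric by (simp add: pseudo_riemannian_metric_def)

lemma metric_diff:
  assumes "v \<in> tangent_space A p" "w \<in> tangent_space A p" "w' \<in> tangent_space A p"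
  shows "g p v (w - w') = g p v w - g p v w'"
  using metric_add[OF assms(1), of w "(-1) *\<^sub>R w'"] metric_scaleR[OF assms(1,3), of "-1"] assms
    subspace_scale[OF subspace_tangent_space[OF atlas] assms(3), of "-1"] by simp

text \<open>Both values at \<open>p\<close> are pushed forward from the identity. The pairing is
  thus a constant function, which every tangent vector annihilates.\<close>

lemma metric_eq_constant:
  assumes "X \<in> \<nn>" "Y \<in> \<nn>"
  shows "g p (X p) (Y p) = ip X Y"
proof -
  have "X (mul p one) = left_push mul p (X one)" "Y (mul p one) = left_push mul p (Y one)"
    using assms by (auto simp: lie_algebra_def)
  then have "X p = left_push mul p (X one)" "Y p = left_push mul p (Y one)"
    by (simp_all add: lie_group_simps[OF group])
  moreover have "g (mul p one) (left_push mul p (X one)) (left_push mul p (Y one)) = g one (X one) (Y one)"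
    using invariant assms[THEN lie_algebra_field, THEN field_tangent, of one]
    by (simp add: left_invariant_metric_def)
  ultimately show ?thesis
    by (simp add: inner_at_def lie_group_simps[OF group])
qed

lemma subspace_lie: "subspace \<nn>"
  using atlas by (rule subspace_lie_algebra)

lemma ip_add: "X \<in> \<nn> \<Longrightarrow> Y \<in> \<nn> \<Longrightarrow> Z \<in> \<nn> \<Longrightarrow> ip X (Y + Z) = ip X Y + ip X Z"
  using metric_add[of "X one" one "Y one" "Z one"]
  by (simp add: inner_at_def lie_algebra_field field_tangent)

lemma ip_scaleR: "X \<in> \<nn> \<Longrightarrow> Y \<in> \<nn> \<Longrightarrow> ip X (c *\<^sub>R Y) = c * ip X Y"
  using metric_scaleR[of "X one" one "Y one" c]
  by (simp add: inner_at_def lie_algebra_field field_tangent scaleR_fun_def)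

lemma ip_sym: "X \<in> \<nn> \<Longrightarrow> Y \<in> \<nn> \<Longrightarrow> ip X Y = ip Y X"
  using metric_sym[of "X one" one "Y one"]
  by (simp add: inner_at_def lie_algebra_field field_tangent)

lemma affine: "affine_connection A D"
  using connection by (simp add: levi_civita_def)

lemma D_field: "X \<in> vector_fields A \<Longrightarrow> Y \<in> vector_fields A \<Longrightarrow> D X Y \<in> vector_fields A"
  using affine by (simp add: affine_connection_def)

lemma D_add_left:
  "X \<in> \<nn> \<Longrightarrow> X' \<in> \<nn> \<Longrightarrow> Y \<in> \<nn> \<Longrightarrow> D (X + X') Y = D X Y + D X' Y"
  using affine by (simp add: affine_connection_def lie_algebra_field)

lemma D_scaleR_left: "X \<in> \<nn> \<Longrightarrow> Y \<in> \<nn> \<Longrightarrow> D (c *\<^sub>R X) Y = c *\<^sub>R D X Y"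
proof -
  assume X: "X \<in> \<nn>" and Y: "Y \<in> \<nn>"
  have "\<forall>f\<in>smooth_functions A. \<forall>X\<in>vector_fields A. \<forall>Y\<in>vector_fields A.
        D (fun_smult f X) Y = fun_smult f (D X Y)"
    using affine unfolding affine_connection_def by blast
  \<comment> \<open>Real scalars enter as constant smooth functions.\<close>
  then have "D (fun_smult (\<lambda>p. c) X) Y = fun_smult (\<lambda>p. c) (D X Y)"
    using X Y lie_algebra_field smooth_functions_const by blast
  then show ?thesis
    by (simp add: fun_smult_def scaleR_fun_def)
qed

lemma D_add_right:
  "X \<in> \<nn> \<Longrightarrow> Y \<in> \<nn> \<Longrightarrow> Y' \<in> \<nn> \<Longrightarrow> D X (Y + Y') = D X Y + D X Y'"
  using affine by (simp add: affine_connection_def linear_map_on_def lie_algebra_field)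

lemma D_scaleR_right: "X \<in> \<nn> \<Longrightarrow> Y \<in> \<nn> \<Longrightarrow> D X (c *\<^sub>R Y) = c *\<^sub>R D X Y"
  using affine by (simp add: affine_connection_def linear_map_on_def lie_algebra_field)

lemma torsion_free: "X \<in> \<nn> \<Longrightarrow> Y \<in> \<nn> \<Longrightarrow> D X Y - D Y X = bracket X Y"
  using connection by (simp add: levi_civita_def lie_algebra_field)

text \<open>Compatibility has a derivative of the pairing of \<open>Y\<close> and \<open>Z\<close>
  on one side. That pairing is constant, so \<open>D X\<close> is skew.\<close>

lemma metric_compatible:
  assumes "X \<in> \<nn>" "Y \<in> \<nn>" "Z \<in> \<nn>"
  shows "g p (D X Y p) (Z p) + g p (Y p) (D X Z p) = 0"
proof -
  have "X p (\<lambda>q. g q (Y q) (Z q)) = g p (D X Y p) (Z p) + g p (Y p) (D X Z p)"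
    using connection assms by (simp add: levi_civita_def lie_algebra_field)
  moreover have "X p (\<lambda>q. g q (Y q) (Z q)) = 0"
    using tangent_vector_const[OF field_tangent[OF lie_algebra_field[OF assms(1)]]]
    by (simp add: metric_eq_constant assms)
  ultimately show ?thesis by simp
qed

text \<open>Three instances of torsion-freeness and three of skewness combine linearly. The gain is
  that the right-hand side does not involve \<open>p\<close>.\<close>

lemma koszul_at:
  assumes br: "\<And>X Y. X \<in> \<nn> \<Longrightarrow> Y \<in> \<nn> \<Longrightarrow> bracket X Y \<in> \<nn>"
    and X: "X \<in> \<nn>" and Y: "Y \<in> \<nn>" and Z: "Z \<in> \<nn>"
  shows "2 * g p (D X Y p) (Z p) = ip (bracket X Y) Z - ip (bracket Y Z) X - ip (bracket X Z) Y"
proof -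
  \<comment> \<open>The derivative stands in the second slot, where
    \<open>pseudo_riemannian_metric\<close> states linearity.\<close>
  define B where "B X Y Z = g p (Z p) (D X Y p)" for X Y Z
  have T: "X p \<in> tangent_space A p" "D X Y p \<in> tangent_space A p" if "X \<in> \<nn>" "Y \<in> \<nn>" for X Y
    using that by (simp_all add: field_tangent lie_algebra_field D_field)
  have comm: "B X Y Z - B Y X Z = ip (bracket X Y) Z" if "X \<in> \<nn>" "Y \<in> \<nn>" "Z \<in> \<nn>" for X Y Z
  proof -
    have "B X Y Z - B Y X Z = g p (Z p) ((D X Y - D Y X) p)"
      using that by (simp add: B_def T metric_diff)
    also have "\<dots> = ip Z (bracket X Y)"
      using metric_eq_constant that br by (simp add: torsion_free)
    finally show ?thesis
      using ip_sym br that by simp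
  qed
  have skew: "B X Y Z + B X Z Y = 0" if "X \<in> \<nn>" "Y \<in> \<nn>" "Z \<in> \<nn>" for X Y Z
    using metric_compatible[OF that, of p] metric_sym T that by (simp add: B_def)
  have "2 * B X Y Z = ip (bracket X Y) Z - ip (bracket Y Z) X - ip (bracket X Z) Y"
    using comm[OF X Y Z] comm[OF Y Z X] comm[OF X Z Y] skew[OF X Y Z] skew[OF Y X Z] skew[OF Z X Y]
    by linarith
  then show ?thesis
    using metric_sym T X Y Z by (simp add: B_def)
qed

text \<open>The value at \<open>mul h p\<close> and the pushed value from \<open>p\<close> have the
  same pairing with every left-invariant field, since \<open>koszul_at\<close> evaluates both to one
  constant. Such fields reach every tangent vector at the point, so nondegeneracy makes the two
  values equal.\<close>

lemma D_closed:
  assumes br: "\<And>X Y. X \<in> \<nn> \<Longrightarrow> Y \<in> \<nn> \<Longrightarrow> bracket X Y \<in> \<nn>"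
    and X: "X \<in> \<nn>" and Y: "Y \<in> \<nn>"
  shows "D X Y \<in> \<nn>"
proof -
  have f: "D X Y \<in> vector_fields A"
    using X Y by (simp add: lie_algebra_field D_field)
  have "D X Y (mul h p) = left_push mul h (D X Y p)" for h p
  proof -
    let ?T = "tangent_space A (mul h p)"
    let ?v = "D X Y (mul h p)" and ?w = "left_push mul h (D X Y p)"
    have v: "?v \<in> ?T" using f by (rule field_tangent)
    have w: "?w \<in> ?T" using group field_tangent[OF f] by (rule left_push_tangent_space)
    have "?v - ?w = 0"
    proof (rule metric_nondegenerate)
      show vw: "?v - ?w \<in> ?T"
        using v w subspace_tangent_space[OF atlas] by (rule subspace_diff[rotated])
      fix t assume t: "t \<in> ?T"
      then obtain Z where Z: "Z \<in> \<nn>" "Z (mul h p) = t"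
        using left_invariant_extension[OF group] by metis
      have "g (mul h p) ?w t = g (mul h p) ?w (left_push mul h (Z p))"
        using Z by (auto simp: lie_algebra_def)
      also have "\<dots> = g p (D X Y p) (Z p)"
        using invariant field_tangent[OF f] field_tangent[OF lie_algebra_field[OF Z(1)]]
        by (simp add: left_invariant_metric_def)
      also have "\<dots> = g (mul h p) ?v t"
        using koszul_at[OF br X Y Z(1), of p] koszul_at[OF br X Y Z(1), of "mul h p"] Z(2) by simp
      finally show "g (mul h p) (?v - ?w) t = 0"
        using metric_diff[OF t v w] metric_sym[OF vw t] metric_sym[OF v t] metric_sym[OF w t] by simp
    qed
    then show ?thesis by simp
  qed
  with f show ?thesis by (simp add: lie_algebra_def)
qed

end

section \<open>Traces and Ricci curvature in 2-step metric Lie algebras\<close>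

lemma linear_map_on_sum:
  assumes S: "subspace S" and f: "linear_map_on S f" and v: "\<And>i. i \<in> I \<Longrightarrow> v i \<in> S"
  shows "f (\<Sum>i\<in>I. c i *\<^sub>R v i) = (\<Sum>i\<in>I. c i *\<^sub>R f (v i))"
  using v
proof (induction I rule: infinite_finite_induct)
  case (insert i I)
  have "c i *\<^sub>R v i \<in> S" "(\<Sum>i\<in>I. c i *\<^sub>R v i) \<in> S"
    using insert.prems by (auto intro!: subspace_scale[OF S] subspace_sum[OF S])
  then show ?case
    using f insert by (simp add: linear_map_on_def)
qed (use f subspace_0[OF S] in \<open>force simp: linear_map_on_def\<close>)+

text \<open>Expanding \<open>f x\<close> in the family \<open>b\<close> for \<open>x\<close> in the
  chosen basis, swapping the sums and recombining the basis coordinates of \<open>b s\<close> gives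
  the claim. The family enters only through its coordinate functionals, so it may consist of dual
  pairs.\<close>

lemma trace_on_eq_sum_coordinates:
  fixes S :: "'a::real_vector set"
  assumes S: "subspace S" and T: "finite T" "\<And>s. s \<in> T \<Longrightarrow> b s \<in> S"
    and c: "\<And>s. s \<in> T \<Longrightarrow> linear_map_on S (c s)"
    and expand: "\<And>x. x \<in> S \<Longrightarrow> x = (\<Sum>s\<in>T. c s x *\<^sub>R b s)"
    and f: "linear_map_on S f" "\<And>x. x \<in> S \<Longrightarrow> f x \<in> S"
  shows "trace_on S f = (\<Sum>s\<in>T. c s (f (b s)))"
proof -
  obtain B0 where B0: "B0 \<subseteq> b ` T" "independent B0" "b ` T \<subseteq> span B0"
    by (rule maximal_independent_subset)
  have "span B0 = S"
  proof
    show "span B0 \<subseteq> S"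
      using B0(1) T(2) by (intro span_minimal S) auto
    show "S \<subseteq> span B0"
    proof
      fix x assume "x \<in> S"
      have "(\<Sum>s\<in>T. c s x *\<^sub>R b s) \<in> span B0"
        using B0(3) by (intro span_sum span_scale) auto
      then show "x \<in> span B0"
        using expand[OF \<open>x \<in> S\<close>] by simp
    qed
  qed
  \<comment> \<open>A finite basis exists, so the choice inside \<open>trace_on\<close> really
    yields one.\<close>
  then have ex: "\<exists>B. finite B \<and> independent B \<and> span B = S"
    using B0 T(1) finite_subset by blast
  define B where "B = (SOME B. finite B \<and> independent B \<and> span B = S)"
  have B: "finite B" "independent B" "span B = S"
    using someI_ex[OF ex] unfolding B_def by auto
  have BS: "x \<in> S" if "x \<in> B" for x
    using that B(3) span_base by blast
  have 1: "representation B (f x) y = (\<Sum>s\<in>T. c s (f x) * representation B (b s) y)"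
    if "x \<in> B" for x y
  proof -
    have "representation B (f x) y = representation B (\<Sum>s\<in>T. c s (f x) *\<^sub>R b s) y"
      using expand[OF f(2)[OF BS[OF that]]] by simp
    also have "\<dots> = (\<Sum>s\<in>T. representation B (c s (f x) *\<^sub>R b s) y)"
      using B T by (subst real_vector.representation_sum) (auto intro: span_scale)
    also have "\<dots> = (\<Sum>s\<in>T. c s (f x) * representation B (b s) y)"
      using B T by (intro sum.cong) (auto simp: representation_scale)
    finally show ?thesis .
  qed
  have 2: "(\<Sum>x\<in>B. c s (f x) * representation B (b s) x) = c s (f (b s))" if "s \<in> T" for s
  proof -
    have cf: "linear_map_on S (\<lambda>x. c s (f x))"
      using c[OF that] f by (simp add: linear_map_on_def)
    have "c s (f (b s)) = c s (f (\<Sum>x\<in>B. representation B (b s) x *\<^sub>R x))"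
      using B T that by (subst sum_representation_eq) auto
    also have "\<dots> = (\<Sum>x\<in>B. representation B (b s) x *\<^sub>R c s (f x))"
      using linear_map_on_sum[OF S cf, of B "\<lambda>x. x"] BS by simp
    finally show ?thesis by (simp add: mult.commute)
  qed
  have "trace_on S f = (\<Sum>x\<in>B. \<Sum>s\<in>T. c s (f x) * representation B (b s) x)"
    by (simp add: trace_on_def B_def[symmetric] 1)
  also have "\<dots> = (\<Sum>s\<in>T. \<Sum>x\<in>B. c s (f x) * representation B (b s) x)"
    by (rule sum.swap)
  finally show ?thesis by (simp add: 2)
qed

section \<open>Algebra of a 2-step nilpotent metric Lie algebra\<close>

text \<open>The left-invariant situation with the manifold forgotten. The linearity laws are
  relative to the carrier because the ambient type also contains fields that are not
  left-invariant.\<close>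

locale two_step_connection =
  fixes \<nn> \<zz> :: "'a::real_vector set"
    and ip :: "'a \<Rightarrow> 'a \<Rightarrow> real" and br nab :: "'a \<Rightarrow> 'a \<Rightarrow> 'a"
  assumes sub: "subspace \<nn>"
    and ip_add_right: "x \<in> \<nn> \<Longrightarrow> y \<in> \<nn> \<Longrightarrow> z \<in> \<nn> \<Longrightarrow> ip x (y + z) = ip x y + ip x z"
    and ip_scale_right: "x \<in> \<nn> \<Longrightarrow> y \<in> \<nn> \<Longrightarrow> ip x (c *\<^sub>R y) = c * ip x y"
    and ip_commute: "x \<in> \<nn> \<Longrightarrow> y \<in> \<nn> \<Longrightarrow> ip x y = ip y x"
    and nab_closed: "x \<in> \<nn> \<Longrightarrow> y \<in> \<nn> \<Longrightarrow> nab x y \<in> \<nn>"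
    and nab_add_left: "x \<in> \<nn> \<Longrightarrow> y \<in> \<nn> \<Longrightarrow> z \<in> \<nn> \<Longrightarrow> nab (x + y) z = nab x z + nab y z"
    and nab_scale_left: "x \<in> \<nn> \<Longrightarrow> y \<in> \<nn> \<Longrightarrow> nab (c *\<^sub>R x) y = c *\<^sub>R nab x y"
    and nab_add_right: "x \<in> \<nn> \<Longrightarrow> y \<in> \<nn> \<Longrightarrow> z \<in> \<nn> \<Longrightarrow> nab x (y + z) = nab x y + nab x z"
    and nab_scale_right: "x \<in> \<nn> \<Longrightarrow> y \<in> \<nn> \<Longrightarrow> nab x (c *\<^sub>R y) = c *\<^sub>R nab x y"
    and nab_torsion: "x \<in> \<nn> \<Longrightarrow> y \<in> \<nn> \<Longrightarrow> nab x y - nab y x = br x y"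
    and nab_metric: "x \<in> \<nn> \<Longrightarrow> y \<in> \<nn> \<Longrightarrow> z \<in> \<nn> \<Longrightarrow> ip (nab x y) z + ip y (nab x z) = 0"
    and br_center: "x \<in> \<nn> \<Longrightarrow> y \<in> \<nn> \<Longrightarrow> br x y \<in> \<zz>"
    and center_eq: "\<zz> = {x \<in> \<nn>. \<forall>y\<in>\<nn>. br x y = 0}"
begin

lemma center_br: "x \<in> \<zz> \<Longrightarrow> y \<in> \<nn> \<Longrightarrow> br x y = 0"
  by (simp add: center_eq)

lemma in_nn:
  "x \<in> \<zz> \<Longrightarrow> x \<in> \<nn>"
  "x \<in> \<nn> \<Longrightarrow> y \<in> \<nn> \<Longrightarrow> br x y \<in> \<nn>" "0 \<in> \<nn>"
  "x \<in> \<nn> \<Longrightarrow> y \<in> \<nn> \<Longrightarrow> x + y \<in> \<nn>" "x \<in> \<nn> \<Longrightarrow> c *\<^sub>R x \<in> \<nn>"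
  "x \<in> \<nn> \<Longrightarrow> y \<in> \<nn> \<Longrightarrow> x - y \<in> \<nn>" "x \<in> \<nn> \<Longrightarrow> - x \<in> \<nn>"
  using center_eq br_center sub
  by (auto simp: subspace_add subspace_scale subspace_0 subspace_diff subspace_neg)

lemmas mem = in_nn nab_closed

lemma ip_add_left: "x \<in> \<nn> \<Longrightarrow> y \<in> \<nn> \<Longrightarrow> z \<in> \<nn> \<Longrightarrow> ip (y + z) x = ip y x + ip z x"
  using ip_add_right ip_commute mem by metis

lemma ip_scale_left: "x \<in> \<nn> \<Longrightarrow> y \<in> \<nn> \<Longrightarrow> ip (c *\<^sub>R y) x = c * ip y x"
  using ip_scale_right ip_commute mem by metis

lemma ip_zero: "x \<in> \<nn> \<Longrightarrow> ip x 0 = 0" "x \<in> \<nn> \<Longrightarrow> ip 0 x = 0"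
  using ip_scale_right[of x x 0] ip_scale_left[of x x 0] by auto

lemma ip_minus: "x \<in> \<nn> \<Longrightarrow> y \<in> \<nn> \<Longrightarrow> ip x (- y) = - ip x y" "x \<in> \<nn> \<Longrightarrow> y \<in> \<nn> \<Longrightarrow> ip (- x) y = - ip x y"
  using ip_scale_right[of x y "-1"] ip_scale_left[of y x "-1"] by auto

lemma ip_diff:
  "x \<in> \<nn> \<Longrightarrow> y \<in> \<nn> \<Longrightarrow> z \<in> \<nn> \<Longrightarrow> ip x (y - z) = ip x y - ip x z"
  "x \<in> \<nn> \<Longrightarrow> y \<in> \<nn> \<Longrightarrow> z \<in> \<nn> \<Longrightarrow> ip (y - z) x = ip y x - ip z x"
  using ip_add_right[of x y "- z"] ip_add_left[of x y "- z"] by (simp_all add: mem ip_minus)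

lemma linear_ip: "x \<in> \<nn> \<Longrightarrow> linear_map_on \<nn> (\<lambda>y. c * ip y x)"
  by (simp add: linear_map_on_def ip_add_left ip_scale_left algebra_simps)

lemma ip_sum_left:
  assumes "y \<in> \<nn>" "\<And>s. s \<in> S \<Longrightarrow> v s \<in> \<nn>"
  shows "ip (\<Sum>s\<in>S. c s *\<^sub>R v s) y = (\<Sum>s\<in>S. c s * ip (v s) y)"
  using linear_map_on_sum[OF sub linear_ip[OF assms(1), of 1], of S v c] assms(2) by simp

lemma sum_scale_mem: "(\<And>s. s \<in> S \<Longrightarrow> v s \<in> \<nn>) \<Longrightarrow> (\<Sum>s\<in>S. c s *\<^sub>R v s) \<in> \<nn>"
  by (intro subspace_sum[OF sub] subspace_scale[OF sub])

lemma br_skew: "x \<in> \<nn> \<Longrightarrow> y \<in> \<nn> \<Longrightarrow> br y x = - br x y"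
  using nab_torsion[of x y] nab_torsion[of y x] by (metis minus_diff_eq)

lemma br_center_right: "x \<in> \<zz> \<Longrightarrow> y \<in> \<nn> \<Longrightarrow> br y x = 0"
  using center_br[of x y] br_skew[of x y] by (simp add: mem)

lemma br_self: "x \<in> \<nn> \<Longrightarrow> br x x = 0"
  using nab_torsion[of x x] by simp

lemma koszul:
  assumes "x \<in> \<nn>" "y \<in> \<nn>" "z \<in> \<nn>"
  shows "2 * ip (nab x y) z = ip (br x y) z - ip (br y z) x - ip (br x z) y"
proof -
  have t: "ip (br a b) c = ip (nab a b) c - ip (nab b a) c" if "a \<in> \<nn>" "b \<in> \<nn>" "c \<in> \<nn>" for a b c
    using ip_diff(2)[of c "nab a b" "nab b a"] nab_torsion[OF that(1,2)] that by (simp add: mem)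
  have k: "ip (nab a b) c = - ip (nab a c) b" if "a \<in> \<nn>" "b \<in> \<nn>" "c \<in> \<nn>" for a b c
    using nab_metric[OF that] ip_commute[of b "nab a c"] that by (simp add: mem)
  show ?thesis
    using t[OF assms] t[OF assms(2,3,1)] t[OF assms(1,3,2)]
      k[OF assms] k[OF assms(2,1,3)] k[OF assms(3,1,2)] by linarith
qed

lemma nab_central: "x \<in> \<zz> \<Longrightarrow> y \<in> \<nn> \<Longrightarrow> nab y x = nab x y"
  using nab_torsion[of x y] center_br[of x y] by (simp add: mem)

text \<open>Two of the three brackets in \<open>koszul\<close> contain the central vector and
  vanish.\<close>

lemma ip_nab_central: "x \<in> \<zz> \<Longrightarrow> y \<in> \<nn> \<Longrightarrow> w \<in> \<nn> \<Longrightarrow> ip (nab x y) w = - (1/2) * ip (br y w) x"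
  using koszul[of x y w] by (simp add: mem center_br ip_zero)

lemma nab_zero: "x \<in> \<nn> \<Longrightarrow> nab 0 x = 0" "x \<in> \<nn> \<Longrightarrow> nab x 0 = 0"
  using nab_scale_left[of x x 0] nab_scale_right[of x x 0] by auto

definition curv :: "'a \<Rightarrow> 'a \<Rightarrow> 'a \<Rightarrow> 'a" where
  "curv w x y = nab w (nab x y) - nab x (nab w y) - nab (br w x) y"

lemma br_add_left: "x \<in> \<nn> \<Longrightarrow> y \<in> \<nn> \<Longrightarrow> z \<in> \<nn> \<Longrightarrow> br (x + y) z = br x z + br y z"
  using nab_add_left[of x y z] nab_add_right[of z x y]
  by (simp add: mem nab_torsion[symmetric])

lemma br_scale_left: "x \<in> \<nn> \<Longrightarrow> y \<in> \<nn> \<Longrightarrow> br (c *\<^sub>R x) y = c *\<^sub>R br x y"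
  by (simp add: mem nab_torsion[symmetric] nab_scale_left nab_scale_right scaleR_diff_right)

lemma curv_closed: "w \<in> \<nn> \<Longrightarrow> x \<in> \<nn> \<Longrightarrow> y \<in> \<nn> \<Longrightarrow> curv w x y \<in> \<nn>"
  by (simp add: curv_def mem)

lemma linear_curv: "x \<in> \<nn> \<Longrightarrow> y \<in> \<nn> \<Longrightarrow> linear_map_on \<nn> (\<lambda>w. curv w x y)"
  by (simp add: curv_def linear_map_on_def mem br_add_left br_scale_left nab_add_left nab_add_right
      nab_scale_left nab_scale_right scaleR_diff_right)

text \<open>Skewness moves the outer derivative to the other argument, so only first derivatives
  remain. For the dual pairs \<open>b\<close>, \<open>d\<close> used in the trace,
  \<open>nab b d\<close> vanishes and the first term drops out.\<close>

lemma ip_curv: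
  assumes "x \<in> \<nn>" "y \<in> \<nn>" "b \<in> \<nn>" "d \<in> \<nn>"
  shows "ip (curv b x y) d = - ip (nab x y) (nab b d) + ip (nab b y) (nab x d) - ip (nab (br b x) y) d"
  using nab_metric[of b "nab x y" d] nab_metric[of x "nab b y" d] assms
  by (simp add: curv_def ip_diff mem)

definition ric :: "'a \<Rightarrow> 'a \<Rightarrow> real" where
  "ric x y = trace_on \<nn> (\<lambda>w. curv w x y)"

end

section \<open>The Ricci form in an adapted frame\<close>

text \<open>The assumption \<open>expansion\<close> encodes the dual pairs: \<open>us\<close> with
  \<open>vs\<close> in both orders, and each \<open>zs\<close> and \<open>es\<close> with itself up
  to sign.\<close>

locale adapted_two_step_connection = two_step_connection \<nn> \<zz> ip br nab
    for \<nn> \<zz> :: "'a::real_vector set" and ip br nab +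
  fixes I :: "'i set" and us vs :: "'i \<Rightarrow> 'a"
    and J :: "'j set" and zs :: "'j \<Rightarrow> 'a" and eps :: "'j \<Rightarrow> real"
    and K :: "'k set" and es :: "'k \<Rightarrow> 'a" and epsbar :: "'k \<Rightarrow> real"
  assumes fin: "finite I" "finite J" "finite K"
    and us: "i \<in> I \<Longrightarrow> us i \<in> \<zz>" "i \<in> I \<Longrightarrow> x \<in> \<zz> \<Longrightarrow> ip (us i) x = 0"
    and vs: "i \<in> I \<Longrightarrow> vs i \<in> \<nn>"
    and zs: "\<alpha> \<in> J \<Longrightarrow> zs \<alpha> \<in> \<zz>"
    and es: "a \<in> K \<Longrightarrow> es a \<in> \<nn>" "a \<in> K \<Longrightarrow> x \<in> \<zz> \<Longrightarrow> ip (es a) x = 0"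
    and expansion: "x \<in> \<nn> \<Longrightarrow> x = (\<Sum>i\<in>I. ip x (vs i) *\<^sub>R us i) + (\<Sum>i\<in>I. ip x (us i) *\<^sub>R vs i)
      + (\<Sum>\<alpha>\<in>J. (eps \<alpha> * ip x (zs \<alpha>)) *\<^sub>R zs \<alpha>) + (\<Sum>a\<in>K. (epsbar a * ip x (es a)) *\<^sub>R es a)"
begin

lemma basis_mem: "i \<in> I \<Longrightarrow> us i \<in> \<nn>" "\<alpha> \<in> J \<Longrightarrow> zs \<alpha> \<in> \<nn>"
  using us zs in_nn(1) by auto

lemmas mem = in_nn basis_mem vs es(1) nab_closed

text \<open>Parseval identity for an indefinite form: the coordinates against \<open>us\<close> and
  \<open>vs\<close> occur crosswise.\<close>

lemma ip_expand:
  assumes "x \<in> \<nn>" "y \<in> \<nn>"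
  shows "ip x y = (\<Sum>i\<in>I. ip x (vs i) * ip y (us i)) + (\<Sum>i\<in>I. ip x (us i) * ip y (vs i))
    + (\<Sum>\<alpha>\<in>J. eps \<alpha> * (ip x (zs \<alpha>) * ip y (zs \<alpha>))) + (\<Sum>a\<in>K. epsbar a * (ip x (es a) * ip y (es a)))"
proof -
  have "ip x y = ip ((\<Sum>i\<in>I. ip x (vs i) *\<^sub>R us i) + (\<Sum>i\<in>I. ip x (us i) *\<^sub>R vs i)
      + (\<Sum>\<alpha>\<in>J. (eps \<alpha> * ip x (zs \<alpha>)) *\<^sub>R zs \<alpha>) + (\<Sum>a\<in>K. (epsbar a * ip x (es a)) *\<^sub>R es a)) y"
    using expansion[OF assms(1)] by simp
  also have "\<dots> = (\<Sum>i\<in>I. ip x (vs i) * ip (us i) y) + (\<Sum>i\<in>I. ip x (us i) * ip (vs i) y)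
    + (\<Sum>\<alpha>\<in>J. eps \<alpha> * ip x (zs \<alpha>) * ip (zs \<alpha>) y) + (\<Sum>a\<in>K. epsbar a * ip x (es a) * ip (es a) y)"
    using assms by (simp add: ip_add_left ip_sum_left sum_scale_mem mem)
  finally show ?thesis
    using assms by (simp add: mem ip_commute[of y] mult.assoc)
qed

lemma ip_nondegenerate:
  assumes "x \<in> \<nn>" "\<And>y. y \<in> \<nn> \<Longrightarrow> ip x y = 0"
  shows "x = 0"
  using expansion[OF assms(1)] assms(2) by (simp add: mem)

lemma ip_center_us: "i \<in> I \<Longrightarrow> x \<in> \<zz> \<Longrightarrow> ip x (us i) = 0"
  using us ip_commute mem by metis

lemma ip_center_es: "a \<in> K \<Longrightarrow> x \<in> \<zz> \<Longrightarrow> ip x (es a) = 0"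
  using es ip_commute mem by metis

text \<open>By \<open>ip_nab_central\<close> every pairing of the derivative is a multiple of a
  bracket paired with \<open>us i\<close>; brackets are central and \<open>us i\<close> is
  orthogonal to the center.\<close>

lemma nab_us:
  assumes "i \<in> I" "x \<in> \<nn>"
  shows "nab (us i) x = 0" "nab x (us i) = 0"
proof -
  show "nab (us i) x = 0"
    using assms by (intro ip_nondegenerate)
      (simp_all add: mem ip_nab_central us(1) ip_center_us br_center)
  then show "nab x (us i) = 0"
    using nab_central[of "us i" x] assms us(1) by simp
qed

lemma ric_sum:
  assumes "x \<in> \<nn>" "y \<in> \<nn>"
  shows "ric x y = (\<Sum>i\<in>I. ip (curv (us i) x y) (vs i)) + (\<Sum>i\<in>I. ip (curv (vs i) x y) (us i))
    + (\<Sum>\<alpha>\<in>J. eps \<alpha> * ip (curv (zs \<alpha>) x y) (zs \<alpha>)) + (\<Sum>a\<in>K. epsbar a * ip (curv (es a) x y) (es a))"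
proof -
  \<comment> \<open>One disjoint sum indexes all four families; the coordinate along
    \<open>us i\<close> is the pairing with its partner \<open>vs i\<close>, and conversely.\<close>
  let ?T = "(I <+> I) <+> (J <+> K)"
  let ?b = "case_sum (case_sum us vs) (case_sum zs es)"
  let ?c = "case_sum (case_sum (\<lambda>i x. 1 * ip x (vs i)) (\<lambda>i x. 1 * ip x (us i)))
    (case_sum (\<lambda>\<alpha> x. eps \<alpha> * ip x (zs \<alpha>)) (\<lambda>a x. epsbar a * ip x (es a)))"
  have "ric x y = (\<Sum>s\<in>?T. ?c s (curv (?b s) x y))"
    unfolding ric_def
  proof (rule trace_on_eq_sum_coordinates)
    show "w = (\<Sum>s\<in>?T. ?c s w *\<^sub>R ?b s)" if "w \<in> \<nn>" for w
      using expansion[OF that] fin by (simp add: sum.Plus add.assoc)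
    show "linear_map_on \<nn> (?c s)" if "s \<in> ?T" for s
      using that linear_ip[of _ 1] by (auto simp: mem linear_ip)
  qed (use assms fin sub linear_curv curv_closed mem in auto)
  then show ?thesis
    using fin by (simp add: sum.Plus add.assoc)
qed

text \<open>Both derivatives are orthogonal to the center, so only the \<open>es\<close> terms of
  \<open>ip_expand\<close> survive. Each factor contributes -1/2, whence 1/4.\<close>

lemma ip_nab_zs:
  assumes "\<alpha> \<in> J" "x \<in> \<nn>" "y \<in> \<nn>"
  shows "ip (nab (zs \<alpha>) x) (nab (zs \<alpha>) y) =
    (\<Sum>a\<in>K. epsbar a * (1/4 * (ip (br x (es a)) (zs \<alpha>) * ip (br y (es a)) (zs \<alpha>))))"
proof -
  have "ip (nab (zs \<alpha>) x) w = 0" if "w \<in> \<zz>" "x \<in> \<nn>" for w x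
    using that assms zs by (simp add: ip_nab_central br_center_right mem ip_zero)
  then show ?thesis
    using assms by (subst ip_expand) (simp_all add: mem us zs ip_nab_central)
qed

text \<open>Pairings with \<open>us\<close> vanish. Against \<open>es\<close> both factors have
  coefficient -1/2, but against \<open>zs\<close> the signs are opposite, because
  \<open>es a\<close> is the first argument of one derivative and the second of the other.\<close>

lemma ip_nab_es:
  assumes "a \<in> K" "x \<in> \<nn>" "y \<in> \<nn>"
  shows "ip (nab (es a) y) (nab x (es a)) =
    (\<Sum>b\<in>K. epsbar b * (1/4 * (ip (br (es a) (es b)) x * ip (br (es a) (es b)) y)))
    - (\<Sum>\<alpha>\<in>J. eps \<alpha> * (1/4 * (ip (br x (es a)) (zs \<alpha>) * ip (br y (es a)) (zs \<alpha>))))"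
proof -
  have u: "ip (nab (es a) y) (us i) = 0" "ip (nab x (es a)) (us i) = 0" if "i \<in> I" for i
    using that assms koszul[of "es a" y "us i"] koszul[of x "es a" "us i"] us
    by (simp_all add: mem br_center_right ip_center_us br_center ip_zero)
  have z: "ip (nab (es a) y) (zs \<alpha>) = - (1/2) * ip (br y (es a)) (zs \<alpha>)"
    "ip (nab x (es a)) (zs \<alpha>) = 1/2 * ip (br x (es a)) (zs \<alpha>)" if "\<alpha> \<in> J" for \<alpha>
    using that assms koszul[of "es a" y "zs \<alpha>"] koszul[of x "es a" "zs \<alpha>"] zs br_skew[of "es a" y]
    by (simp_all add: mem br_center_right br_center ip_zero ip_minus)
  have e: "ip (nab (es a) y) (es b) = - (1/2) * ip (br (es a) (es b)) y"
    "ip (nab x (es a)) (es b) = - (1/2) * ip (br (es a) (es b)) x" if "b \<in> K" for b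
    using that assms koszul[of "es a" y "es b"] koszul[of x "es a" "es b"]
    by (simp_all add: mem ip_center_es br_center)
  show ?thesis
    using assms by (subst ip_expand) (simp_all add: mem u z e sum_negf mult.commute)
qed

text \<open>The \<open>zs\<close> contribute 1/4 of the first double sum. The \<open>es\<close>
  contribute -3/4 of it, namely -1/4 from \<open>ip_nab_es\<close> and -1/2 from the bracket term of
  the curvature, together with all of the second double sum.\<close>

lemma ric_formula:
  assumes x: "x \<in> \<nn>" and y: "y \<in> \<nn>"
  shows "ric x y =
    - 1/2 * (\<Sum>\<alpha>\<in>J. eps \<alpha> * (\<Sum>a\<in>K. epsbar a * (ip (br x (es a)) (zs \<alpha>) * ip (br y (es a)) (zs \<alpha>))))
    + 1/4 * (\<Sum>a\<in>K. epsbar a * (\<Sum>b\<in>K. epsbar b * (ip (br (es a) (es b)) x * ip (br (es a) (es b)) y)))"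
proof -
  \<comment> \<open>\<open>P a\<close> is the pairing of the central vectors
    \<open>br x (es a)\<close> and \<open>br y (es a)\<close>; \<open>R\<close> collects the same
    products with the roles of the two indices exchanged.\<close>
  define P where "P a = (\<Sum>\<alpha>\<in>J. eps \<alpha> * (ip (br x (es a)) (zs \<alpha>) * ip (br y (es a)) (zs \<alpha>)))" for a
  define Q where "Q a = (\<Sum>b\<in>K. epsbar b * (ip (br (es a) (es b)) x * ip (br (es a) (es b)) y))" for a
  define R where "R \<alpha> = (\<Sum>a\<in>K. epsbar a * (ip (br x (es a)) (zs \<alpha>) * ip (br y (es a)) (zs \<alpha>)))" for \<alpha>
  have u: "ip (curv (us i) x y) (vs i) = 0" if "i \<in> I" for i
    using that x y us by (simp add: ip_curv mem nab_us ip_zero center_br nab_zero)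
  \<comment> \<open>In the bracket term, skewness shifts the derivative onto \<open>us i\<close>,
    where \<open>nab_us\<close> kills it.\<close>
  have v: "ip (curv (vs i) x y) (us i) = 0" if "i \<in> I" for i
    using that x y us nab_metric[of "br (vs i) x" y "us i"]
    by (simp add: ip_curv mem nab_us ip_zero)
  have z: "ip (curv (zs \<alpha>) x y) (zs \<alpha>) = 1/4 * R \<alpha>" if "\<alpha> \<in> J" for \<alpha>
  proof -
    have "nab (zs \<alpha>) (zs \<alpha>) = 0"
      using that zs by (intro ip_nondegenerate) (simp_all add: mem ip_nab_central center_br ip_zero)
    then have "ip (curv (zs \<alpha>) x y) (zs \<alpha>) = ip (nab (zs \<alpha>) y) (nab (zs \<alpha>) x)"
      using that x y zs nab_central[of "zs \<alpha>" x] by (simp add: ip_curv mem ip_zero center_br nab_zero)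
    then show ?thesis
      using ip_nab_zs[OF that y x] by (simp add: R_def sum_distrib_left mult_ac)
  qed
  have e: "ip (curv (es a) x y) (es a) = 1/4 * Q a - 3/4 * P a" if a: "a \<in> K" for a
  proof -
    have "nab (es a) (es a) = 0"
    proof (rule ip_nondegenerate)
      show "ip (nab (es a) (es a)) w = 0" if "w \<in> \<nn>" for w
        using that a koszul[of "es a" "es a" w]
        by (simp add: mem br_self ip_zero ip_center_es br_center)
    qed (simp add: mem a)
    moreover have "ip (nab (br (es a) x) y) (es a) = 1/2 * ip (br y (es a)) (br x (es a))"
    proof -
      have "ip (nab (br (es a) x) y) (es a) = - (1/2) * ip (br y (es a)) (br (es a) x)"
        using a x y by (simp add: ip_nab_central br_center mem)
      moreover have "ip (br y (es a)) (br (es a) x) = - ip (br y (es a)) (br x (es a))"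
        using a x y br_skew[of x "es a"] by (simp add: ip_minus mem)
      ultimately show ?thesis by simp
    qed
    moreover have "ip (br y (es a)) (br x (es a)) = P a"
      using a x y by (subst ip_expand)
        (simp_all add: mem ip_center_us ip_center_es br_center P_def mult.commute)
    ultimately have "ip (curv (es a) x y) (es a) = ip (nab (es a) y) (nab x (es a)) - 1/2 * P a"
      using a x y by (simp add: ip_curv mem ip_zero)
    moreover have "ip (nab (es a) y) (nab x (es a)) = 1/4 * Q a - 1/4 * P a"
      using ip_nab_es[OF a x y] by (simp add: P_def Q_def sum_distrib_left mult_ac)
    ultimately show ?thesis by linarith
  qed
  have swap: "(\<Sum>\<alpha>\<in>J. eps \<alpha> * R \<alpha>) = (\<Sum>a\<in>K. epsbar a * P a)"
    unfolding P_def R_def sum_distrib_left by (subst sum.swap) (simp add: mult_ac)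
  have "ric x y = (\<Sum>\<alpha>\<in>J. eps \<alpha> * (1/4 * R \<alpha>)) + (\<Sum>a\<in>K. epsbar a * (1/4 * Q a - 3/4 * P a))"
    by (simp add: ric_sum x y u v z e)
  also have "\<dots> = 1/4 * (\<Sum>\<alpha>\<in>J. eps \<alpha> * R \<alpha>) + 1/4 * (\<Sum>a\<in>K. epsbar a * Q a) - 3/4 * (\<Sum>a\<in>K. epsbar a * P a)"
    by (simp add: right_diff_distrib sum_subtractf sum_distrib_left mult_ac)
  also have "\<dots> = - 1/2 * (\<Sum>\<alpha>\<in>J. eps \<alpha> * R \<alpha>) + 1/4 * (\<Sum>a\<in>K. epsbar a * Q a)"
    unfolding swap by simp
  finally show ?thesis by (simp add: Q_def R_def)
qed

end

section \<open>The adapted decomposition\<close>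

lemma is_basis_sum:
  assumes "is_basis S I b" "x \<in> S"
  obtains c where "x = (\<Sum>i\<in>I. c i *\<^sub>R b i)"
proof -
  have "x \<in> range (\<lambda>u. \<Sum>v\<in>b ` I. u v *\<^sub>R v)"
    using assms span_finite[of "b ` I"] by (auto simp: is_basis_def)
  then obtain u where "x = (\<Sum>v\<in>b ` I. u v *\<^sub>R v)"
    by blast
  then have "x = (\<Sum>i\<in>I. u (b i) *\<^sub>R b i)"
    using assms by (simp add: is_basis_def sum.reindex)
  then show thesis by (rule that)
qed

lemma is_basis_subspace: "is_basis S I b \<Longrightarrow> subspace S"
  using subspace_span[of "b ` I"] by (simp add: is_basis_def)

lemma is_basis_mem: "is_basis S I b \<Longrightarrow> i \<in> I \<Longrightarrow> b i \<in> S"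
  using span_base[of "b i" "b ` I"] by (simp add: is_basis_def)

lemma sum_delta_mult:
  fixes c d :: "'s \<Rightarrow> real"
  assumes "finite S" "k \<in> S" "\<And>i. i \<in> S \<Longrightarrow> f i = (if i = k then d i else 0)"
  shows "(\<Sum>i\<in>S. c i * f i) = c k * d k"
proof -
  have "(\<Sum>i\<in>S. c i * f i) = (\<Sum>i\<in>S. if i = k then c i * d i else 0)"
    using assms(3) by (intro sum.cong) auto
  then show ?thesis using assms(1,2) by (simp add: sum.delta)
qed

lemma sum_spaceI1: "0 \<in> T \<Longrightarrow> x \<in> S \<Longrightarrow> x \<in> sum_space S T"
  unfolding sum_space_def by force

lemma sum_spaceI2: "0 \<in> S \<Longrightarrow> x \<in> T \<Longrightarrow> x \<in> sum_space S T"
  unfolding sum_space_def by force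

section \<open>Completeness of the adapted basis\<close>

locale adapted_decomposition = two_step_connection \<nn> \<zz> ip br nab
    for \<nn> \<zz> :: "'a::real_vector set" and ip br nab +
  fixes \<UU> \<VV> \<ZZ> \<EE> :: "'a set"
    and I :: "'i set" and us vs :: "'i \<Rightarrow> 'a"
    and J :: "'j set" and zs :: "'j \<Rightarrow> 'a" and eps :: "'j \<Rightarrow> real"
    and K :: "'k set" and es :: "'k \<Rightarrow> 'a" and epsbar :: "'k \<Rightarrow> real"
  assumes U_eq: "\<UU> = \<zz> \<inter> perp ip \<nn> \<zz>"
    and V_sub: "\<VV> \<subseteq> \<nn>" and V_null: "v \<in> \<VV> \<Longrightarrow> v' \<in> \<VV> \<Longrightarrow> ip v v' = 0"
    and Z_eq: "\<ZZ> = \<zz> \<inter> perp ip \<nn> \<UU> \<inter> perp ip \<nn> \<VV>"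
    and E_eq: "\<EE> = perp ip \<nn> \<UU> \<inter> perp ip \<nn> \<VV> \<inter> perp ip \<nn> \<ZZ>"
    and U_basis: "is_basis \<UU> I us" and V_basis: "is_basis \<VV> I vs"
    and pairing: "i \<in> I \<Longrightarrow> k \<in> I \<Longrightarrow> ip (us i) (vs k) = (if i = k then 1 else 0)"
    and Z_basis: "is_basis \<ZZ> J zs" and eps: "\<alpha> \<in> J \<Longrightarrow> eps \<alpha> = 1 \<or> eps \<alpha> = - 1"
    and Z_orthonormal: "\<alpha> \<in> J \<Longrightarrow> \<beta> \<in> J \<Longrightarrow> ip (zs \<alpha>) (zs \<beta>) = (if \<alpha> = \<beta> then eps \<alpha> else 0)"
    and E_basis: "is_basis \<EE> K es" and epsbar: "a \<in> K \<Longrightarrow> epsbar a = 1 \<or> epsbar a = - 1"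
    and E_orthonormal: "a \<in> K \<Longrightarrow> b \<in> K \<Longrightarrow> ip (es a) (es b) = (if a = b then epsbar a else 0)"
begin

lemma spaces_mem:
  "x \<in> \<UU> \<Longrightarrow> x \<in> \<nn>" "x \<in> \<VV> \<Longrightarrow> x \<in> \<nn>" "x \<in> \<ZZ> \<Longrightarrow> x \<in> \<nn>" "x \<in> \<EE> \<Longrightarrow> x \<in> \<nn>"
  "x \<in> \<UU> \<Longrightarrow> x \<in> \<zz>" "x \<in> \<ZZ> \<Longrightarrow> x \<in> \<zz>"
  using U_eq V_sub Z_eq E_eq in_nn(1) by (auto simp: perp_def)

lemmas basis_mem = is_basis_mem[OF U_basis] is_basis_mem[OF V_basis] is_basis_mem[OF Z_basis]
  is_basis_mem[OF E_basis]

lemma perp_sym: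
  "x \<in> perp ip \<nn> S \<Longrightarrow> y \<in> S \<Longrightarrow> ip x y = 0"
  "x \<in> perp ip \<nn> S \<Longrightarrow> y \<in> S \<Longrightarrow> y \<in> \<nn> \<Longrightarrow> ip y x = 0"
  using ip_commute[of x y] by (simp_all add: perp_def)

lemma U_perp: "u \<in> \<UU> \<Longrightarrow> x \<in> \<zz> \<Longrightarrow> ip u x = 0" "u \<in> \<UU> \<Longrightarrow> x \<in> \<zz> \<Longrightarrow> ip x u = 0"
  using perp_sym[of u \<zz> x] U_eq in_nn(1) by auto

lemma Z_perp:
  "z \<in> \<ZZ> \<Longrightarrow> u \<in> \<UU> \<Longrightarrow> ip z u = 0" "z \<in> \<ZZ> \<Longrightarrow> u \<in> \<UU> \<Longrightarrow> ip u z = 0"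
  "z \<in> \<ZZ> \<Longrightarrow> v \<in> \<VV> \<Longrightarrow> ip z v = 0" "z \<in> \<ZZ> \<Longrightarrow> v \<in> \<VV> \<Longrightarrow> ip v z = 0"
  using perp_sym[of z \<UU> u] perp_sym[of z \<VV> v] Z_eq spaces_mem(1,2) by auto

lemma E_perp:
  "e \<in> \<EE> \<Longrightarrow> u \<in> \<UU> \<Longrightarrow> ip e u = 0" "e \<in> \<EE> \<Longrightarrow> u \<in> \<UU> \<Longrightarrow> ip u e = 0"
  "e \<in> \<EE> \<Longrightarrow> v \<in> \<VV> \<Longrightarrow> ip e v = 0" "e \<in> \<EE> \<Longrightarrow> v \<in> \<VV> \<Longrightarrow> ip v e = 0"
  "e \<in> \<EE> \<Longrightarrow> z \<in> \<ZZ> \<Longrightarrow> ip e z = 0" "e \<in> \<EE> \<Longrightarrow> z \<in> \<ZZ> \<Longrightarrow> ip z e = 0"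
  using perp_sym[of e \<UU> u] perp_sym[of e \<VV> v] perp_sym[of e \<ZZ> z] E_eq spaces_mem(1-3) by auto

lemma pairing_left: "i \<in> I \<Longrightarrow> k \<in> I \<Longrightarrow> ip (vs i) (us k) = (if i = k then 1 else 0)"
  using pairing[of k i] ip_commute[of "vs i" "us k"] by (simp add: spaces_mem basis_mem eq_commute)

lemma finite_index: "finite I" "finite J" "finite K"
  using U_basis Z_basis E_basis by (auto simp: is_basis_def)

lemma perp_basisI:
  assumes b: "is_basis S T b" and S: "S \<subseteq> \<nn>" and x: "x \<in> \<nn>" and "\<And>i. i \<in> T \<Longrightarrow> ip (b i) x = 0"
  shows "x \<in> perp ip \<nn> S"
proof -
  have "ip x y = 0" if y: "y \<in> S" for y
  proof -
    obtain c where "y = (\<Sum>i\<in>T. c i *\<^sub>R b i)"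
      using b y by (rule is_basis_sum)
    then have "ip y x = 0"
      using ip_sum_left[OF x, of T b c] is_basis_mem[OF b] S assms(4) by auto
    then show ?thesis using ip_commute[of x y] y S x by auto
  qed
  then show ?thesis using x by (simp add: perp_def)
qed

text \<open>The center is the sum of \<open>\<UU>\<close> and \<open>\<ZZ>\<close>: removing from
  \<open>x\<close> its component \<open>w\<close> in \<open>\<UU>\<close>, with coefficients read
  off by pairing with \<open>vs\<close>, leaves a central vector orthogonal to \<open>\<UU>\<close>
  and \<open>\<VV>\<close>. Both pieces are orthogonal to \<open>e\<close>.\<close>

lemma E_perp_center:
  assumes e: "e \<in> \<EE>" and x: "x \<in> \<zz>"
  shows "ip e x = 0" "ip x e = 0"
proof -
  have xn: "x \<in> \<nn>" using x by (rule in_nn)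
  define w where "w = (\<Sum>i\<in>I. ip x (vs i) *\<^sub>R us i)"
  have wU: "w \<in> \<UU>" unfolding w_def
    by (intro subspace_sum subspace_scale is_basis_subspace[OF U_basis] basis_mem)
  note w = spaces_mem(1,5)[OF wU]
  have dn: "x - w \<in> \<nn>" using xn w(1) by (rule mem(6))
  have "br (x - w) y = 0" if "y \<in> \<nn>" for y
    using br_add_left[of x "- w" y] br_scale_left[of w y "-1"] that w x by (simp add: mem center_br)
  then have dz: "x - w \<in> \<zz>"
    using dn by (simp add: center_eq)
  have "x - w \<in> perp ip \<nn> \<UU>"
    using dn dz U_perp by (simp add: perp_def)
  moreover have "x - w \<in> perp ip \<nn> \<VV>"
  proof (rule perp_basisI[OF V_basis V_sub dn])
    fix k assume k: "k \<in> I"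
    have "ip w (vs k) = ip x (vs k) * 1"
      unfolding w_def using k finite_index
      by (subst ip_sum_left, simp_all add: spaces_mem basis_mem)
        (subst sum_delta_mult[of _ k _ "\<lambda>_. 1"], auto simp: pairing)
    then show "ip (vs k) (x - w) = 0"
      using ip_diff(1)[of "vs k" x w] ip_commute[of "vs k"] k w xn by (simp add: spaces_mem basis_mem)
  qed
  ultimately have "x - w \<in> \<ZZ>" using dz by (simp add: Z_eq)
  then have "ip e (x - w) = 0" using e E_perp by blast
  then show "ip e x = 0"
    using ip_diff(1)[of e x w] E_perp(1)[OF e wU] xn w e by (simp add: spaces_mem)
  then show "ip x e = 0"
    using ip_commute[of e x] xn e by (simp add: spaces_mem)
qed

text \<open>The difference \<open>d\<close> of the two sides is orthogonal to all basis vectors.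
  Orthogonality to \<open>us\<close>, \<open>vs\<close> and \<open>zs\<close> puts it in
  \<open>\<EE>\<close> by definition, and orthogonality to \<open>es\<close> then annihilates its
  coordinates there.\<close>

lemma adapted_expansion:
  assumes x: "x \<in> \<nn>"
  shows "x = (\<Sum>i\<in>I. ip x (vs i) *\<^sub>R us i) + (\<Sum>i\<in>I. ip x (us i) *\<^sub>R vs i)
      + (\<Sum>\<alpha>\<in>J. (eps \<alpha> * ip x (zs \<alpha>)) *\<^sub>R zs \<alpha>) + (\<Sum>a\<in>K. (epsbar a * ip x (es a)) *\<^sub>R es a)"
    (is "x = ?P")
proof -
  note m = spaces_mem basis_mem
  define d where "d = x - ?P"
  have P: "?P \<in> \<nn>"
    by (intro mem(4) sum_scale_mem) (auto intro: m)
  have d: "d \<in> \<nn>"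
    unfolding d_def using x P by (rule mem(6))
  have P_ip: "ip ?P y = (\<Sum>i\<in>I. ip x (vs i) * ip (us i) y) + (\<Sum>i\<in>I. ip x (us i) * ip (vs i) y)
      + (\<Sum>\<alpha>\<in>J. eps \<alpha> * ip x (zs \<alpha>) * ip (zs \<alpha>) y) + (\<Sum>a\<in>K. epsbar a * ip x (es a) * ip (es a) y)"
    if "y \<in> \<nn>" for y
    using that by (simp add: ip_add_left ip_sum_left sum_scale_mem m mem)
  have ip_d: "ip y d = 0" if "y \<in> \<nn>" "ip ?P y = ip x y" for y
    using ip_diff(2)[OF that(1) x P] ip_commute[OF that(1) d] that by (simp add: d_def)
  have du: "ip (us k) d = 0" if k: "k \<in> I" for k
  proof (rule ip_d)
    show "ip ?P (us k) = ip x (us k)"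
      using k sum_delta_mult[OF finite_index(1) k, of "\<lambda>i. ip (vs i) (us k)" "\<lambda>_. 1"]
      by (subst P_ip) (simp_all add: m U_perp Z_perp E_perp pairing_left)
  qed (simp add: k m)
  have dv: "ip (vs k) d = 0" if k: "k \<in> I" for k
  proof (rule ip_d)
    show "ip ?P (vs k) = ip x (vs k)"
      using k sum_delta_mult[OF finite_index(1) k, of "\<lambda>i. ip (us i) (vs k)" "\<lambda>_. 1"]
      by (subst P_ip) (simp_all add: m V_null Z_perp E_perp pairing)
  qed (simp add: k m)
  have dz: "ip (zs k) d = 0" if k: "k \<in> J" for k
  proof (rule ip_d)
    show "ip ?P (zs k) = ip x (zs k)"
      using k eps[OF k] sum_delta_mult[OF finite_index(2) k, of "\<lambda>i. ip (zs i) (zs k)" eps]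
      by (subst P_ip) (auto simp: m Z_perp E_perp Z_orthonormal)
  qed (simp add: k m)
  have de: "ip (es k) d = 0" if k: "k \<in> K" for k
  proof (rule ip_d)
    show "ip ?P (es k) = ip x (es k)"
      using k epsbar[OF k] sum_delta_mult[OF finite_index(3) k, of "\<lambda>i. ip (es i) (es k)" epsbar]
      by (subst P_ip) (auto simp: m E_perp E_orthonormal)
  qed (simp add: k m)
  have "d \<in> \<EE>"
    unfolding E_eq using du dv dz d
    by (auto intro: perp_basisI[OF U_basis] perp_basisI[OF V_basis] perp_basisI[OF Z_basis] spaces_mem)
  then obtain c where c: "d = (\<Sum>a\<in>K. c a *\<^sub>R es a)"
    by (rule is_basis_sum[OF E_basis])
  have "c k = 0" if k: "k \<in> K" for k
  proof -
    have "ip d (es k) = c k * epsbar k"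
      unfolding c using k finite_index
      by (subst ip_sum_left, simp_all add: m)
        (subst sum_delta_mult[of _ k _ epsbar], auto simp: E_orthonormal)
    then show ?thesis using de[OF k] epsbar[OF k] ip_commute[OF d, of "es k"] k by (auto simp: m)
  qed
  then have "d = 0" using c by simp
  then show ?thesis by (simp add: d_def)
qed

sublocale adapted_two_step_connection \<nn> \<zz> ip br nab I us vs J zs eps K es epsbar
proof unfold_locales
qed (rule adapted_expansion finite_index | simp add: spaces_mem basis_mem E_perp_center U_perp; fail)+

end

section \<open>The involution and the map \<open>j\<close>\<close>

locale adapted_involution = adapted_decomposition +
  fixes \<iota> :: "'a \<Rightarrow> 'a" and j :: "'a \<Rightarrow> 'a \<Rightarrow> 'a"
  assumes iota_linear: "linear_map_on \<nn> \<iota>"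
    and iota_us: "i \<in> I \<Longrightarrow> \<iota> (us i) = vs i" and iota_vs: "i \<in> I \<Longrightarrow> \<iota> (vs i) = us i"
    and iota_zs: "\<alpha> \<in> J \<Longrightarrow> \<iota> (zs \<alpha>) = eps \<alpha> *\<^sub>R zs \<alpha>"
    and iota_es: "a \<in> K \<Longrightarrow> \<iota> (es a) = epsbar a *\<^sub>R es a"
    and j_closed: "c \<in> sum_space \<UU> \<ZZ> \<Longrightarrow> x \<in> sum_space \<VV> \<EE> \<Longrightarrow> j c x \<in> sum_space \<VV> \<EE>"
    and j_adjoint: "c \<in> sum_space \<UU> \<ZZ> \<Longrightarrow> x \<in> sum_space \<VV> \<EE> \<Longrightarrow> y \<in> sum_space \<VV> \<EE> \<Longrightarrow>
      ip (j c x) (\<iota> y) = ip (br x y) (\<iota> c)"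
begin

lemmas zero_mem = subspace_0[OF is_basis_subspace[OF U_basis]] subspace_0[OF is_basis_subspace[OF V_basis]]
  subspace_0[OF is_basis_subspace[OF Z_basis]] subspace_0[OF is_basis_subspace[OF E_basis]]

text \<open>For \<open>v\<close> in \<open>\<VV>\<close> this makes the image of \<open>v\<close> an
  admissible first argument of \<open>j\<close>, and turns the right-hand side of
  \<open>j_adjoint\<close> into a pairing with \<open>v\<close> itself.\<close>

lemma iota_V:
  assumes "v \<in> \<VV>"
  shows "\<iota> v \<in> sum_space \<UU> \<ZZ>" "\<iota> (\<iota> v) = v"
proof -
  obtain c where c: "v = (\<Sum>i\<in>I. c i *\<^sub>R vs i)"
    using V_basis assms by (rule is_basis_sum)
  have iv: "\<iota> v = (\<Sum>i\<in>I. c i *\<^sub>R us i)"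
    unfolding c by (subst linear_map_on_sum[OF sub iota_linear])
      (simp_all add: iota_vs spaces_mem basis_mem)
  then have "\<iota> v \<in> \<UU>"
    by (auto intro!: subspace_sum subspace_scale is_basis_subspace[OF U_basis] basis_mem)
  then show "\<iota> v \<in> sum_space \<UU> \<ZZ>"
    by (intro sum_spaceI1 zero_mem)
  have "\<iota> (\<Sum>i\<in>I. c i *\<^sub>R us i) = (\<Sum>i\<in>I. c i *\<^sub>R vs i)"
    by (subst linear_map_on_sum[OF sub iota_linear]) (simp_all add: iota_us spaces_mem basis_mem)
  then show "\<iota> (\<iota> v) = v"
    by (simp only: iv c[symmetric])
qed

lemma iota_Z:
  assumes "z \<in> \<ZZ>"
  shows "\<iota> z \<in> sum_space \<UU> \<ZZ>" "\<iota> (\<iota> z) = z"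
proof -
  obtain c where c: "z = (\<Sum>i\<in>J. c i *\<^sub>R zs i)"
    using Z_basis assms by (rule is_basis_sum)
  have iz: "\<iota> z = (\<Sum>i\<in>J. (c i * eps i) *\<^sub>R zs i)"
    unfolding c by (subst linear_map_on_sum[OF sub iota_linear])
      (simp_all add: iota_zs spaces_mem basis_mem)
  then have "\<iota> z \<in> \<ZZ>"
    by (auto intro!: subspace_sum subspace_scale is_basis_subspace[OF Z_basis] basis_mem)
  then show "\<iota> z \<in> sum_space \<UU> \<ZZ>"
    by (intro sum_spaceI2 zero_mem)
  have "c i * eps i * eps i = c i" if "i \<in> J" for i
    using eps[OF that] by auto
  then have "\<iota> (\<Sum>i\<in>J. (c i * eps i) *\<^sub>R zs i) = (\<Sum>i\<in>J. c i *\<^sub>R zs i)"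
    by (subst linear_map_on_sum[OF sub iota_linear])
      (auto simp: iota_zs spaces_mem basis_mem intro!: sum.cong)
  then show "\<iota> (\<iota> z) = z"
    by (simp only: iz c[symmetric])
qed

lemma VE_mem: "x \<in> sum_space \<VV> \<EE> \<Longrightarrow> x \<in> \<nn>"
  unfolding sum_space_def using mem(4) spaces_mem(2,4) by blast

text \<open>Elements of \<open>sum_space \<VV> \<EE>\<close> pair to zero with \<open>vs\<close> and
  \<open>zs\<close>. Pairings with \<open>us\<close> need not vanish, but in
  \<open>ip_expand\<close> each is multiplied by one with \<open>vs\<close>.\<close>

lemma ip_VE:
  assumes "p \<in> sum_space \<VV> \<EE>" "q \<in> sum_space \<VV> \<EE>"
  shows "ip p q = (\<Sum>a\<in>K. epsbar a * (ip p (es a) * ip q (es a)))"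
proof -
  have *: "p \<in> \<nn>" "i \<in> I \<Longrightarrow> ip p (vs i) = 0" "\<alpha> \<in> J \<Longrightarrow> ip p (zs \<alpha>) = 0"
    if "p \<in> sum_space \<VV> \<EE>" for p i \<alpha>
    using VE_mem[OF that] that unfolding sum_space_def
    by (auto simp: ip_add_left spaces_mem basis_mem V_null E_perp Z_perp)
  show ?thesis
    using assms * by (subst ip_expand) simp_all
qed

text \<open>The involution scales \<open>es a\<close> by its sign, which is its own inverse and so
  moves across the equation.\<close>

lemma ip_j_es:
  assumes "c \<in> sum_space \<UU> \<ZZ>" "x \<in> sum_space \<VV> \<EE>" "a \<in> K"
  shows "ip (j c x) (es a) = epsbar a * ip (br x (es a)) (\<iota> c)"
proof -
  have "es a \<in> sum_space \<VV> \<EE>"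
    using assms by (intro sum_spaceI2 zero_mem basis_mem)
  from j_adjoint[OF assms(1,2) this]
  have "ip (j c x) (epsbar a *\<^sub>R es a) = ip (br x (es a)) (\<iota> c)"
    using assms by (simp add: iota_es)
  moreover have "j c x \<in> \<nn>"
    using j_closed[OF assms(1,2)] by (rule VE_mem)
  ultimately show ?thesis
    using epsbar[OF assms(3)] assms(3) by (auto simp: ip_scale_right spaces_mem basis_mem ip_minus)
qed

lemma ip_j_j:
  assumes "c \<in> sum_space \<UU> \<ZZ>" "c' \<in> sum_space \<UU> \<ZZ>" "x \<in> sum_space \<VV> \<EE>" "x' \<in> sum_space \<VV> \<EE>"
  shows "ip (j c x) (j c' x') = (\<Sum>a\<in>K. epsbar a * (ip (br x (es a)) (\<iota> c) * ip (br x' (es a)) (\<iota> c')))"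
proof -
  have "epsbar a * (ip (j c x) (es a) * ip (j c' x') (es a)) =
    epsbar a * (ip (br x (es a)) (\<iota> c) * ip (br x' (es a)) (\<iota> c'))" if "a \<in> K" for a
    using epsbar[OF that] assms that by (auto simp: ip_j_es)
  then show ?thesis
    unfolding ip_VE[OF j_closed[OF assms(1,3)] j_closed[OF assms(2,4)]] by (intro sum.cong refl)
qed

text \<open>The involution gives \<open>eps \<alpha>\<close> once in each factor, and the two signs
  cancel.\<close>

lemma sum_j_zs:
  assumes "x \<in> sum_space \<VV> \<EE>" "y \<in> sum_space \<VV> \<EE>"
  shows "(\<Sum>\<alpha>\<in>J. eps \<alpha> * ip (j (zs \<alpha>) x) (j (zs \<alpha>) y)) =
    (\<Sum>\<alpha>\<in>J. eps \<alpha> * (\<Sum>a\<in>K. epsbar a * (ip (br x (es a)) (zs \<alpha>) * ip (br y (es a)) (zs \<alpha>))))"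
proof (rule sum.cong)
  fix \<alpha> assume \<alpha>: "\<alpha> \<in> J"
  have n: "x \<in> \<nn>" "y \<in> \<nn>"
    using assms VE_mem by auto
  have "zs \<alpha> \<in> sum_space \<UU> \<ZZ>"
    using \<alpha> by (intro sum_spaceI2 zero_mem basis_mem)
  then have "ip (j (zs \<alpha>) x) (j (zs \<alpha>) y) =
    (\<Sum>a\<in>K. epsbar a * (ip (br x (es a)) (zs \<alpha>) * ip (br y (es a)) (zs \<alpha>)))"
    using eps[OF \<alpha>] assms \<alpha> n
    by (auto simp: ip_j_j iota_zs ip_scale_right spaces_mem basis_mem mem ip_minus)
  then show "eps \<alpha> * ip (j (zs \<alpha>) x) (j (zs \<alpha>) y) =
    eps \<alpha> * (\<Sum>a\<in>K. epsbar a * (ip (br x (es a)) (zs \<alpha>) * ip (br y (es a)) (zs \<alpha>)))"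
    by simp
qed simp

lemma sum_j_es:
  assumes "x \<in> \<VV> \<union> \<ZZ>" "y \<in> \<VV> \<union> \<ZZ>"
  shows "(\<Sum>a\<in>K. epsbar a * ip (j (\<iota> x) (es a)) (j (\<iota> y) (es a))) =
    (\<Sum>a\<in>K. epsbar a * (\<Sum>b\<in>K. epsbar b * (ip (br (es a) (es b)) x * ip (br (es a) (es b)) y)))"
proof (rule sum.cong)
  fix a assume a: "a \<in> K"
  then have "es a \<in> sum_space \<VV> \<EE>"
    by (intro sum_spaceI2 zero_mem basis_mem)
  then show "epsbar a * ip (j (\<iota> x) (es a)) (j (\<iota> y) (es a)) =
    epsbar a * (\<Sum>b\<in>K. epsbar b * (ip (br (es a) (es b)) x * ip (br (es a) (es b)) y))"
    using assms iota_V iota_Z by (auto simp: ip_j_j)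
qed simp

text \<open>In \<open>ric_formula\<close> the first double sum vanishes when an argument is central,
  the second when an argument is orthogonal to the center. The surviving sums are rewritten by
  \<open>sum_j_zs\<close> and \<open>sum_j_es\<close>; the case \<open>\<VV> \<union> \<ZZ>\<close>
  covers two of the stated identities.\<close>

lemma adapted_ricci:
  shows "u \<in> \<UU> \<Longrightarrow> x \<in> \<nn> \<Longrightarrow> ric u x = 0"
    and "x \<in> \<VV> \<union> \<ZZ> \<Longrightarrow> z \<in> \<ZZ> \<Longrightarrow> ric x z = 1/4 * (\<Sum>a\<in>K. epsbar a * ip (j (\<iota> x) (es a)) (j (\<iota> z) (es a)))"
    and "e \<in> \<EE> \<Longrightarrow> z \<in> \<ZZ> \<Longrightarrow> ric e z = 0"
    and "v \<in> \<VV> \<Longrightarrow> v' \<in> \<VV> \<Longrightarrow> ric v v' =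
      - 1/2 * (\<Sum>\<alpha>\<in>J. eps \<alpha> * ip (j (zs \<alpha>) v) (j (zs \<alpha>) v'))
      + 1/4 * (\<Sum>a\<in>K. epsbar a * ip (j (\<iota> v) (es a)) (j (\<iota> v') (es a)))"
    and "x \<in> sum_space \<VV> \<EE> \<Longrightarrow> e \<in> \<EE> \<Longrightarrow> ric x e =
      - 1/2 * (\<Sum>\<alpha>\<in>J. eps \<alpha> * ip (j (zs \<alpha>) x) (j (zs \<alpha>) e))"
proof -
  have z: "ip (br z (es a)) (zs \<alpha>) = 0" if "z \<in> \<zz>" "a \<in> K" "\<alpha> \<in> J" for z a \<alpha>
    using that by (simp add: center_br mem ip_zero)
  have b: "br (es a) (es b) \<in> \<zz>" if "a \<in> K" "b \<in> K" for a b
    using that by (simp add: br_center mem)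
  show "ric u x = 0" if "u \<in> \<UU>" "x \<in> \<nn>" for u x
    using that by (simp add: ric_formula spaces_mem z b U_perp)
  show "ric x z = 1/4 * (\<Sum>a\<in>K. epsbar a * ip (j (\<iota> x) (es a)) (j (\<iota> z) (es a)))"
    if "x \<in> \<VV> \<union> \<ZZ>" "z \<in> \<ZZ>" for x z
    using that by (subst sum_j_es) (auto simp: ric_formula spaces_mem z)
  show "ric e z = 0" if "e \<in> \<EE>" "z \<in> \<ZZ>" for e z
    using that by (simp add: ric_formula spaces_mem z b E_perp_center)
  show "ric v v' = - 1/2 * (\<Sum>\<alpha>\<in>J. eps \<alpha> * ip (j (zs \<alpha>) v) (j (zs \<alpha>) v'))
      + 1/4 * (\<Sum>a\<in>K. epsbar a * ip (j (\<iota> v) (es a)) (j (\<iota> v') (es a)))"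
    if "v \<in> \<VV>" "v' \<in> \<VV>" for v v'
  proof -
    have "v \<in> sum_space \<VV> \<EE>" "v' \<in> sum_space \<VV> \<EE>"
      using that by (auto intro: sum_spaceI1 zero_mem)
    then show ?thesis
      using that by (simp add: sum_j_zs sum_j_es ric_formula spaces_mem)
  qed
  show "ric x e = - 1/2 * (\<Sum>\<alpha>\<in>J. eps \<alpha> * ip (j (zs \<alpha>) x) (j (zs \<alpha>) e))"
    if "x \<in> sum_space \<VV> \<EE>" "e \<in> \<EE>" for x e
  proof -
    have "e \<in> sum_space \<VV> \<EE>"
      using that by (auto intro: sum_spaceI2 zero_mem)
    moreover have "x \<in> \<nn>"
      using that VE_mem by auto
    ultimately show ?thesis
      using that by (simp add: sum_j_zs ric_formula spaces_mem b E_perp_center)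
  qed
qed

end

section \<open>Transfer to the Lie group\<close>

theorem theorem3p24:
  fixes A :: "('g::{t2_space,second_countable_topology}, 'e::euclidean_space) atlas"
    and mul :: "'g \<Rightarrow> 'g \<Rightarrow> 'g" and one :: 'g and iv :: "'g \<Rightarrow> 'g"
    and g :: "'g metric_tensor"
    and D :: "'g vector_field \<Rightarrow> 'g vector_field \<Rightarrow> 'g vector_field"
    and ip :: "'g vector_field \<Rightarrow> 'g vector_field \<Rightarrow> real"
    and \<nn> \<zz> \<UU> \<VV> \<ZZ> \<EE> :: "'g vector_field set"
    and I :: "'i set" and us vs :: "'i \<Rightarrow> 'g vector_field"
    and J :: "'j set" and zs :: "'j \<Rightarrow> 'g vector_field" and eps :: "'j \<Rightarrow> real"
    and K :: "'k set" and es :: "'k \<Rightarrow> 'g vector_field" and epsbar :: "'k \<Rightarrow> real"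
    and \<iota> :: "'g vector_field \<Rightarrow> 'g vector_field"
    and j :: "'g vector_field \<Rightarrow> 'g vector_field \<Rightarrow> 'g vector_field"
  assumes "lie_group A mul one iv"
    and "connected (UNIV :: 'g set)"
    and "pseudo_riemannian_metric A g"
    and "left_invariant_metric A mul g"
    and "levi_civita A g D"
    and "\<nn> = lie_algebra A mul"
    and "\<zz> = lie_center \<nn>"
    and "\<forall>x\<in>\<nn>. \<forall>y\<in>\<nn>. bracket x y \<in> \<zz>"
    and "ip = inner_at g one"
    (* the decomposition of the Lie algebra *)
    and "\<UU> = \<zz> \<inter> perp ip \<nn> \<zz>"
    and "subspace \<VV>" and "\<VV> \<subseteq> \<nn>" and "dim \<VV> = dim \<UU>"
    and "\<forall>v\<in>\<VV>. \<forall>v'\<in>\<VV>. ip v v' = 0"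
    and "\<forall>u\<in>\<UU>. (\<forall>v\<in>\<VV>. ip u v = 0) \<longrightarrow> u = 0"
    and "\<forall>v\<in>\<VV>. (\<forall>u\<in>\<UU>. ip u v = 0) \<longrightarrow> v = 0"
    and "\<ZZ> = \<zz> \<inter> perp ip \<nn> \<UU> \<inter> perp ip \<nn> \<VV>"
    and "\<EE> = perp ip \<nn> \<UU> \<inter> perp ip \<nn> \<VV> \<inter> perp ip \<nn> \<ZZ>"
    (* the adapted bases *)
    and "is_basis \<UU> I us" and "is_basis \<VV> I vs"
    and "\<forall>i\<in>I. \<forall>k\<in>I. ip (us i) (vs k) = (if i = k then 1 else 0)"
    and "is_basis \<ZZ> J zs" and "\<forall>\<alpha>\<in>J. eps \<alpha> = 1 \<or> eps \<alpha> = - 1"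
    and "\<forall>\<alpha>\<in>J. \<forall>\<beta>\<in>J. ip (zs \<alpha>) (zs \<beta>) = (if \<alpha> = \<beta> then eps \<alpha> else 0)"
    and "is_basis \<EE> K es" and "\<forall>a\<in>K. epsbar a = 1 \<or> epsbar a = - 1"
    and "\<forall>a\<in>K. \<forall>b\<in>K. ip (es a) (es b) = (if a = b then epsbar a else 0)"
    (* the involution and the map j *)
    and "linear_map_on \<nn> \<iota>"
    and "\<forall>i\<in>I. \<iota> (us i) = vs i" and "\<forall>i\<in>I. \<iota> (vs i) = us i"
    and "\<forall>\<alpha>\<in>J. \<iota> (zs \<alpha>) = eps \<alpha> *\<^sub>R zs \<alpha>"
    and "\<forall>a\<in>K. \<iota> (es a) = epsbar a *\<^sub>R es a"
    and "\<forall>a\<in>sum_space \<UU> \<ZZ>. j a ` sum_space \<VV> \<EE> \<subseteq> sum_space \<VV> \<EE>"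
    and "\<forall>a\<in>sum_space \<UU> \<ZZ>. linear_map_on (sum_space \<VV> \<EE>) (j a)"
    and "\<forall>a\<in>sum_space \<UU> \<ZZ>. \<forall>x\<in>sum_space \<VV> \<EE>. \<forall>y\<in>sum_space \<VV> \<EE>.
           ip (j a x) (\<iota> y) = ip (bracket x y) (\<iota> a)"
  shows "(\<forall>u\<in>\<UU>. \<forall>x\<in>\<nn>. ricci A mul D u x = 0) \<and>
         (\<forall>z\<in>\<ZZ>. \<forall>z'\<in>\<ZZ>. ricci A mul D z z' =
           1/4 * (\<Sum>a\<in>K. epsbar a * ip (j (\<iota> z) (es a)) (j (\<iota> z') (es a)))) \<and>
         (\<forall>v\<in>\<VV>. \<forall>z\<in>\<ZZ>. ricci A mul D v z =
           1/4 * (\<Sum>a\<in>K. epsbar a * ip (j (\<iota> v) (es a)) (j (\<iota> z) (es a)))) \<and>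
         (\<forall>e\<in>\<EE>. \<forall>z\<in>\<ZZ>. ricci A mul D e z = 0) \<and>
         (\<forall>v\<in>\<VV>. \<forall>v'\<in>\<VV>. ricci A mul D v v' =
           - 1/2 * (\<Sum>\<alpha>\<in>J. eps \<alpha> * ip (j (zs \<alpha>) v) (j (zs \<alpha>) v'))
           + 1/4 * (\<Sum>a\<in>K. epsbar a * ip (j (\<iota> v) (es a)) (j (\<iota> v') (es a)))) \<and>
         (\<forall>x\<in>sum_space \<VV> \<EE>. \<forall>e\<in>\<EE>. ricci A mul D x e =
           - 1/2 * (\<Sum>\<alpha>\<in>J. eps \<alpha> * ip (j (zs \<alpha>) x) (j (zs \<alpha>) e)))"
proof -
  interpret G: left_invariant_levi_civita A mul one iv g D
    by unfold_locales (use assms(1,3-5) in auto)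
  have n: "\<nn> = lie_algebra A mul" and ip: "ip = inner_at g one"
    and br: "\<And>x y. x \<in> \<nn> \<Longrightarrow> y \<in> \<nn> \<Longrightarrow> bracket x y \<in> \<zz>" and z: "\<zz> = lie_center \<nn>"
    using assms(6-9) by auto
  \<comment> \<open>Closure under brackets, required by \<open>D_closed\<close>, comes from the
    2-step hypothesis because the center lies in the Lie algebra.\<close>
  have br_n: "bracket x y \<in> \<nn>" if "x \<in> \<nn>" "y \<in> \<nn>" for x y
    using br[OF that] by (simp add: z lie_center_def)
  interpret two_step_connection \<nn> \<zz> ip bracket D
  proof
    show "subspace \<nn>" unfolding n by (rule G.subspace_lie)
    show "D x y \<in> \<nn>" if "x \<in> \<nn>" "y \<in> \<nn>" for x y
      using that br_n unfolding n by (intro G.D_closed)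
    show "ip (D x y) w + ip y (D x w) = 0" if "x \<in> \<nn>" "y \<in> \<nn>" "w \<in> \<nn>" for x y w
      using that G.metric_compatible unfolding n ip inner_at_def by blast
    show "\<zz> = {x \<in> \<nn>. \<forall>y\<in>\<nn>. bracket x y = 0}"
      unfolding z lie_center_def ..
  qed (use br in \<open>simp_all add: n ip G.ip_add G.ip_scaleR G.ip_sym G.D_add_left G.D_scaleR_left
      G.D_add_right G.D_scaleR_right G.torsion_free\<close>)
  interpret adapted_involution \<nn> \<zz> ip bracket D \<UU> \<VV> \<ZZ> \<EE> I us vs J zs eps K es epsbar \<iota> j
  proof
    show "j c x \<in> sum_space \<VV> \<EE>" if "c \<in> sum_space \<UU> \<ZZ>" "x \<in> sum_space \<VV> \<EE>" for c x
      using assms(33) that by blast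
  qed (use assms in \<open>simp_all\<close>)
  have "ricci A mul D x y = ric x y" for x y
    by (simp add: ricci_def ric_def curvature_def curv_def flip: n)
  then show ?thesis
    using adapted_ricci by simp
qed

end
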